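(* Let $h\in SL(2,\mathbf{Z})$ be hyperbolic and not conjugate to its inverse in $SL(2,\mathbf{Z})$, and let $\Phi=\{\phi_1,\phi_2,\dots\}\subset SL(2,\mathbf{Z})$ be a sequence such that the sequence $\operatorname{trace}(\phi_i)$ is bounded. For $t\in\mathbf{N}$ put $f^{(n)}(t)=\phi_n h^t\cdots\phi_2h^t\phi_1h^t$, $n\in\mathbf{N}$. Then there is some $t_0$ such that for all $t\in\mathbf{N}$ with $t>t_0$ and for all H\"older functions $F_1,F_2$ on the torus $\mathbf{T}=\mathbf{R}^2/\mathbf{Z}^2$ the correlations $C(F_1,F_2;f^{(n)}(t))$ decay exponentially in $n$: there are constants $c,\gamma>0$ such that $$|C(F_1,F_2;f^{(n)}(t))|\le c\,e^{-\gamma n}\qquad\text{for all } n\in\mathbf{N}.$$ (Here $t_0$ may depend on $h$ and $\Phi$; the constants $c,\gamma$ may depend on $h,\Phi,t,F_1,F_2$.)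
   Context: An element $h\in SL(2,\mathbf{Z})$ is hyperbolic if $|\operatorname{trace}(h)|>2$. The group $SL(2,\mathbf{Z})$ acts on $\mathbf{T}=\mathbf{R}^2/\mathbf{Z}^2$ by its linear action. $\mathbf{N}$ denotes the positive integers. For a sequence $(f^{(n)})$ in $SL(2,\mathbf{Z})$ and $F_1,F_2\in L^2(\mathbf{T})$, $$C(F_1,F_2;f^{(n)})=\int_{\mathbf{T}}F_1(f^{(n)}(x))F_2(x)\,dx-\int_{\mathbf{T}}F_1(x)\,dx\int_{\mathbf{T}}F_2(x)\,dx.$$ A function $F$ on $\mathbf{T}$ is H\"older if for some $\gamma'>0$ there is a constant $c'>0$ such that $|F(x)-F(y)|\le c'\|x-y\|^{\gamma'}$ for all $x,y\in\mathbf{T}$, where $\|x-y\|$ is the distance on the torus. *)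

theory Defs
  imports "HOL-Analysis.Analysis"
begin

section \<open>The group of integer matrices of determinant one\<close>

definition SL2Z :: "(int ^ 2 ^ 2) set" where
  "SL2Z = {A. det A = 1}"

definition hyperbolic :: "int ^ 2 ^ 2 \<Rightarrow> bool" where
  "hyperbolic A \<longleftrightarrow> \<bar>trace A\<bar> > 2"

definition conjugate_SL2Z :: "int ^ 2 ^ 2 \<Rightarrow> int ^ 2 ^ 2 \<Rightarrow> bool" where
  "conjugate_SL2Z A B \<longleftrightarrow> (\<exists>g\<in>SL2Z. B = g ** A ** matrix_inv g)"

text \<open>Multiplication on the type of vectors is componentwise, so that the overloaded power
  does not give the powers of a matrix.\<close>

primrec matrix_power :: "int ^ 2 ^ 2 \<Rightarrow> nat \<Rightarrow> int ^ 2 ^ 2" where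
  "matrix_power A 0 = mat 1"
| "matrix_power A (Suc n) = A ** matrix_power A n"

text \<open>The product \<open>\<phi> n ** h\<^sup>t ** \<dots> ** \<phi> 1 ** h\<^sup>t\<close>. The sequence \<open>\<phi>\<close> is
  indexed from \<open>1\<close>; the value \<open>\<phi> 0\<close> is never used.\<close>

primrec kicked_product :: "int ^ 2 ^ 2 \<Rightarrow> (nat \<Rightarrow> int ^ 2 ^ 2) \<Rightarrow> nat \<Rightarrow> nat \<Rightarrow> int ^ 2 ^ 2" where
  "kicked_product h \<phi> t 0 = mat 1"
| "kicked_product h \<phi> t (Suc n) = \<phi> (Suc n) ** matrix_power h t ** kicked_product h \<phi> t n"


section \<open>The torus\<close>

definition torus_rel :: "real ^ 2 \<Rightarrow> real ^ 2 \<Rightarrow> bool" where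
  "torus_rel u v \<longleftrightarrow> (\<forall>i. u $ i - v $ i \<in> \<int>)"

lemma equivp_torus_rel: "equivp torus_rel"
proof (rule equivpI)
  show "reflp torus_rel" by (simp add: reflp_def torus_rel_def)
  show "symp torus_rel"
    unfolding symp_def torus_rel_def by (metis Ints_minus minus_diff_eq)
  show "transp torus_rel"
    unfolding transp_def torus_rel_def
  proof (intro allI impI)
    fix x y z :: "real ^ 2" and i
    assume "\<forall>i. x $ i - y $ i \<in> \<int>" "\<forall>i. y $ i - z $ i \<in> \<int>"
    then have "(x $ i - y $ i) + (y $ i - z $ i) \<in> \<int>" by (intro Ints_add) auto
    then show "x $ i - z $ i \<in> \<int>" by simp
  qed
qed

quotient_type torus = "real ^ 2" / torus_rel
  by (rule equivp_torus_rel)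

lift_definition torus_proj :: "real ^ 2 \<Rightarrow> torus" is "\<lambda>u. u" .

lemma torus_proj_eq_iff: "torus_proj u = torus_proj v \<longleftrightarrow> torus_rel u v"
  by transfer simp

lemma torus_proj_surj: "\<exists>u. x = torus_proj u"
  by transfer (meson equivp_reflp equivp_torus_rel)

lift_definition torus_act :: "int ^ 2 ^ 2 \<Rightarrow> torus \<Rightarrow> torus" is
  "\<lambda>A u. map_matrix real_of_int A *v u"
proof -
  fix A :: "int ^ 2 ^ 2" and u v :: "real ^ 2"
  assume uv: "torus_rel u v"
  have "(map_matrix real_of_int A *v u) $ i - (map_matrix real_of_int A *v v) $ i
      = (\<Sum>j\<in>UNIV. real_of_int (A $ i $ j) * (u $ j - v $ j))" for i
    by (simp add: matrix_vector_mult_def sum_subtractf right_diff_distrib)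
  moreover have "(\<Sum>j\<in>UNIV. real_of_int (A $ i $ j) * (u $ j - v $ j)) \<in> \<int>" for i
    using uv by (intro Ints_sum Ints_mult) (auto simp: torus_rel_def)
  ultimately show "torus_rel (map_matrix real_of_int A *v u) (map_matrix real_of_int A *v v)"
    by (simp add: torus_rel_def)
qed

lemma torus_act_proj: "torus_act A (torus_proj u) = torus_proj (map_matrix real_of_int A *v u)"
  by transfer (simp add: equivp_reflp[OF equivp_torus_rel])


subsection \<open>Quotient metric\<close>

definition torus_fiber :: "torus \<Rightarrow> (real ^ 2) set" where
  "torus_fiber x = {u. torus_proj u = x}"

lemma torus_fiber_nonempty: "torus_fiber x \<noteq> {}"
  using torus_proj_surj[of x] by (auto simp: torus_fiber_def)

lemma closed_torus_fiber: "closed (torus_fiber x)"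
proof -
  obtain v where v: "x = torus_proj v" using torus_proj_surj by blast
  have "torus_fiber x = (\<Inter>i. (\<lambda>u. u $ i - v $ i) -` \<int>)"
    by (auto simp: torus_fiber_def v torus_proj_eq_iff torus_rel_def)
  moreover have "closed ((\<lambda>u::real ^ 2. u $ i - v $ i) -` \<int>)" for i
    by (rule closed_vimage) (auto intro!: continuous_intros)
  ultimately show ?thesis by auto
qed

lemma torus_fiber_translate:
  assumes "torus_rel u u'" "w \<in> torus_fiber x"
  shows "w - u + u' \<in> torus_fiber x"
proof -
  have "torus_rel (w - u + u') w"
    using equivp_symp[OF equivp_torus_rel assms(1)] by (simp add: torus_rel_def)
  then show ?thesis using assms(2) by (auto simp: torus_fiber_def torus_proj_eq_iff[symmetric])
qed

lemma infdist_torus_fiber_le: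
  assumes "torus_rel u u'"
  shows "infdist u' (torus_fiber x) \<le> infdist u (torus_fiber x)"
proof -
  have "infdist u' (torus_fiber x) \<le> dist u w" if "w \<in> torus_fiber x" for w
  proof -
    have "infdist u' (torus_fiber x) \<le> dist u' (w - u + u')"
      by (rule infdist_le[OF torus_fiber_translate[OF assms that]])
    also have "\<dots> = dist u w" by (simp add: dist_norm)
    finally show ?thesis .
  qed
  then show ?thesis
    unfolding infdist_notempty[OF torus_fiber_nonempty, of u]
    by (intro cINF_greatest) (auto simp: torus_fiber_nonempty)
qed

lemma setdist_torus_fiber:
  "setdist (torus_fiber (torus_proj u)) (torus_fiber y) = infdist u (torus_fiber y)"
proof (rule antisym)
  have u: "u \<in> torus_fiber (torus_proj u)" by (simp add: torus_fiber_def)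
  show "setdist (torus_fiber (torus_proj u)) (torus_fiber y) \<le> infdist u (torus_fiber y)"
    using setdist_le_sing[OF u] by (simp add: setdist_eq_infdist)
  show "infdist u (torus_fiber y) \<le> setdist (torus_fiber (torus_proj u)) (torus_fiber y)"
    unfolding setdist_eq_infdist[of "torus_fiber (torus_proj u)"]
  proof (simp only: torus_fiber_nonempty if_False, rule cINF_greatest)
    fix w assume "w \<in> torus_fiber (torus_proj u)"
    then have "torus_rel w u" by (simp add: torus_fiber_def torus_proj_eq_iff)
    then show "infdist u (torus_fiber y) \<le> infdist w (torus_fiber y)"
      by (rule infdist_torus_fiber_le)
  qed (rule torus_fiber_nonempty)
qed

instantiation torus :: metric_space
begin

definition dist_torus :: "torus \<Rightarrow> torus \<Rightarrow> real" where
  "dist_torus x y = setdist (torus_fiber x) (torus_fiber y)"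

definition uniformity_torus :: "(torus \<times> torus) filter" where
  "uniformity_torus = (INF e\<in>{0<..}. principal {(x, y). dist x y < e})"

definition open_torus :: "torus set \<Rightarrow> bool" where
  "open_torus U \<longleftrightarrow> (\<forall>x\<in>U. eventually (\<lambda>(x', y). x' = x \<longrightarrow> y \<in> U) uniformity)"

instance
proof
  fix x y z :: torus
  obtain u where u: "x = torus_proj u" using torus_proj_surj by blast
  obtain v where v: "y = torus_proj v" using torus_proj_surj by blast
  show "dist x y = 0 \<longleftrightarrow> x = y"
  proof -
    have "dist x y = 0 \<longleftrightarrow> u \<in> torus_fiber y"
      using in_closed_iff_infdist_zero[OF closed_torus_fiber torus_fiber_nonempty]
      by (simp add: dist_torus_def u setdist_torus_fiber)
    then show ?thesis by (simp add: torus_fiber_def u)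
  qed
  show "dist x y \<le> dist x z + dist y z"
  proof -
    have "infdist u (torus_fiber y) - dist y z \<le> dist u w" if "w \<in> torus_fiber z" for w
    proof -
      have w: "z = torus_proj w" using that by (simp add: torus_fiber_def)
      have "infdist u (torus_fiber y) \<le> infdist w (torus_fiber y) + dist u w"
        by (rule infdist_triangle)
      also have "infdist w (torus_fiber y) = dist y z"
        by (simp add: dist_torus_def setdist_sym[of "torus_fiber y"] w setdist_torus_fiber)
      finally show ?thesis by simp
    qed
    then have "infdist u (torus_fiber y) - dist y z \<le> infdist u (torus_fiber z)"
      unfolding infdist_notempty[OF torus_fiber_nonempty, of u z]
      by (intro cINF_greatest) (auto simp: torus_fiber_nonempty)
    then show ?thesis by (simp add: dist_torus_def u setdist_torus_fiber)
  qed
qed (simp_all only: uniformity_torus_def open_torus_def)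

end

lemma dist_torus_proj_le: "dist (torus_proj u) (torus_proj v) \<le> dist u v"
  unfolding dist_torus_def by (rule setdist_le_dist) (simp_all add: torus_fiber_def)

lemma continuous_torus_proj: "continuous_on UNIV torus_proj"
  unfolding continuous_on_iff using dist_torus_proj_le by (meson le_less_trans)


subsection \<open>Lebesgue measure on the torus\<close>

definition unit_square :: "(real ^ 2) set" where
  "unit_square = {u. \<forall>i. 0 \<le> u $ i \<and> u $ i < 1}"

definition torus_measure :: "torus measure" where
  "torus_measure = distr (restrict_space lborel unit_square) borel torus_proj"

lemma torus_proj_measurable: "torus_proj \<in> borel_measurable (restrict_space lborel unit_square)"
  by (intro measurable_restrict_space1)
    (simp add: borel_measurable_continuous_onI continuous_torus_proj)

lemma unit_square_sets: "unit_square \<in> sets borel"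
proof -
  have eq: "unit_square = (\<Inter>i\<in>UNIV. {u. 0 \<le> u $ i} \<inter> {u. u $ i < 1})"
    by (auto simp: unit_square_def)
  have "{u :: real ^ 2. 0 \<le> u $ i} \<inter> {u. u $ i < 1} \<in> sets borel" for i
    by (intro sets.Int borel_closed borel_open closed_Collect_le open_Collect_less)
      (auto intro!: continuous_intros)
  then show ?thesis
    unfolding eq by (intro sets.finite_INT) auto
qed

lemma emeasure_torus_measure: "emeasure torus_measure (space torus_measure) = 1"
proof -
  have "emeasure torus_measure (space torus_measure) = emeasure lborel unit_square"
    using torus_proj_measurable unit_square_sets
    by (simp add: torus_measure_def emeasure_distr emeasure_restrict_space space_restrict_space)
  also have "\<dots> = 1"
  proof (rule antisym)
    have one: "(\<Prod>b\<in>Basis. (1 :: real ^ 2) \<bullet> b) = 1"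
      by (intro prod.neutral) (auto simp: Basis_vec_def inner_axis)
    have z: "0 \<le> (1 :: real ^ 2) \<bullet> b" if "b \<in> Basis" for b
      using that by (auto simp: Basis_vec_def inner_axis)
    have "emeasure lborel unit_square \<le> emeasure lborel (cbox 0 (1 :: real ^ 2))"
      by (intro emeasure_mono) (auto simp: unit_square_def mem_box_cart less_imp_le)
    then show "emeasure lborel unit_square \<le> 1"
      using z by (simp add: emeasure_lborel_cbox one)
    have "emeasure lborel (box 0 (1 :: real ^ 2)) \<le> emeasure lborel unit_square"
      using unit_square_sets
      by (intro emeasure_mono) (auto simp: unit_square_def mem_box_cart less_imp_le)
    then show "1 \<le> emeasure lborel unit_square"
      using z by (simp add: emeasure_lborel_box one)
  qed
  finally show ?thesis .
qed


section \<open>Hoelder functions and correlations\<close>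

definition hoelder :: "(torus \<Rightarrow> complex) \<Rightarrow> bool" where
  "hoelder F \<longleftrightarrow> (\<exists>\<gamma>>0. \<exists>c>0. \<forall>x y. norm (F x - F y) \<le> c * dist x y powr \<gamma>)"

definition correlation :: "(torus \<Rightarrow> complex) \<Rightarrow> (torus \<Rightarrow> complex) \<Rightarrow> int ^ 2 ^ 2 \<Rightarrow> complex" where
  "correlation F1 F2 A =
     (LINT x|torus_measure. F1 (torus_act A x) * F2 x)
     - (LINT x|torus_measure. F1 x) * (LINT x|torus_measure. F2 x)"

end

theory Submission
  imports Defs "HOL-Library.Sublist"
begin

text \<open>Fourier expansion turns the decay of correlations into a statement about integer vectors. The
  integral of \<open>F1 (A x) * F2 x\<close> only couples a frequency \<open>k\<close> of \<open>F1\<close> with the frequency \<open>- k A\<close> of \<open>F2\<close>,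
  where \<open>A\<close> acts on rows from the right. Call a nonzero row \<open>k\<close> a resonance of size \<open>N\<close> if the entries
  of \<open>k\<close> and of \<open>k A\<close> are at most \<open>N\<close> in absolute value. Fejer means approximate a Hoelder function by
  trigonometric polynomials with frequencies at most \<open>N\<close> up to an error that is a negative power of
  \<open>N\<close>, so if \<open>A\<close> has no resonance of size \<open>N\<close>, the correlation is at most a constant times a negative
  power of \<open>N\<close> (\<open>correlation_le_of_resonance_free\<close>). The remaining claim is that the product of \<open>n\<close>
  kicked steps has no resonance up to a size that grows exponentially in \<open>n\<close>
  (\<open>kicked_product_resonance_free\<close>).

  Large entries do not exclude resonances, as powers of a unipotent matrix show: they fix a row. The
  quantity to follow is a quasimorphism that is bounded on unipotent matrices. Up to quarter turns on
  both sides, every matrix in \<open>SL(2,Z)\<close> is a product of the two positive elementary matrices, hence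
  spelled by a word over two letters. Inversion mirrors the word: it reverses the order and exchanges
  the letters. Count the occurrences of a fixed pattern \<open>u\<close> in the word, minus those in the mirrored
  word. When two matrices are multiplied, the end of one word cancels against the beginning of the
  other exactly as far as these are mirror images, and the cancelled parts had contributed with
  opposite signs; therefore the count is additive up to a bounded error (\<open>spells_product\<close>,
  \<open>brooks_mult\<close>). This is the counting quasimorphism of Brooks for the free product
  \<open>PSL(2,Z)\<close> of the cyclic groups of orders 2 and 3.

  Three facts then give the claim.

  \<^item> The hyperbolic matrix \<open>h\<close> is, up to sign and conjugation, the matrix of a word \<open>u\<close>; take this word
  as the pattern. As \<open>h\<close> is not conjugate to its inverse, \<open>u\<close> is not a cyclic rotation of its mirror
  image and so does not occur in a power of it. Hence the quasimorphism is at least \<open>t - O(1)\<close> on the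
  power \<open>t\<close> of \<open>h\<close> (\<open>brooks_power\<close>).

  \<^item> A matrix of bounded trace is conjugate to one from a finite set or to plus or minus a unipotent
  matrix. Conjugation changes a quasimorphism by a bounded amount, however large the conjugating
  matrix, so the kicks have bounded values (\<open>brooks_bounded_trace\<close>). For \<open>t\<close> beyond the sum of these
  bounds, each kicked step adds at least 1.

  \<^item> A resonance of size \<open>N\<close> writes \<open>A\<close> as a product of a unipotent matrix and two matrices whose
  entries are polynomial in \<open>N\<close>. The quasimorphism is at most logarithmic in the entries
  (\<open>brooks_growth\<close>), so its value at \<open>A\<close> is \<open>O(log N)\<close> (\<open>row_resonance_bound\<close>). A value of at least
  \<open>n - O(1)\<close> therefore forces \<open>N\<close> to be exponentially large in \<open>n\<close>.\<close>

section \<open>Patterns in words over two letters\<close>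

text \<open>The word of the inverse: the two letters stand for the two positive elementary matrices, and each
  of these is inverted, up to a quarter turn, by the other one.\<close>

definition mirror :: "bool list \<Rightarrow> bool list" where
  "mirror p = rev (map Not p)"

lemma mirror_simps [simp]:
  "mirror [] = []" "mirror (a # p) = mirror p @ [\<not> a]" "mirror (p @ q) = mirror q @ mirror p"
  "mirror (mirror p) = p" "length (mirror p) = length p"
  by (simp_all add: mirror_def rev_map comp_def)

text \<open>Occurrences may overlap. This costs at most \<open>length u\<close> occurrences at each junction and keeps the
  recursion simple.\<close>

fun occ :: "'a list \<Rightarrow> 'a list \<Rightarrow> nat" where
  "occ u [] = 0"
| "occ u (x # xs) = (if prefix u (x # xs) then 1 else 0) + occ u xs"

lemma occ_append_ge: "occ u xs + occ u ys \<le> occ u (xs @ ys)"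
proof (induction xs)
  case (Cons x xs)
  have "prefix u (x # xs) \<Longrightarrow> prefix u (x # xs @ ys)"
    using prefix_prefix[of u "x # xs" ys] by simp
  then show ?case using Cons by auto
qed simp

lemma occ_append_le: "occ u (xs @ ys) \<le> occ u xs + occ u ys + length u"
proof -
  have "occ u (xs @ ys) \<le> occ u xs + occ u ys + min (length xs) (length u)"
  proof (induction xs)
    case (Cons x xs)
    have "prefix u (x # xs) \<or> length (x # xs) < length u" if "prefix u ((x # xs) @ ys)"
      using that by (metis not_less prefix_length_prefix prefixI)
    then show ?case using Cons by auto
  qed simp
  then show ?thesis by linarith
qed

text \<open>Counting in the mirrored word with opposite sign makes the count odd under inversion, so that parts
  which cancel in a product also cancel in the count.\<close>

definition bias :: "bool list \<Rightarrow> bool list \<Rightarrow> int" where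
  "bias u p = int (occ u p) - int (occ u (mirror p))"

lemma bias_Nil [simp]: "bias u [] = 0"
  by (simp add: bias_def)

lemma bias_mirror [simp]: "bias u (mirror p) = - bias u p"
  by (simp add: bias_def)

lemma bias_singleton: "\<bar>bias u [a]\<bar> \<le> 1"
  by (simp add: bias_def)

lemma bias_append: "\<bar>bias u (p @ q) - bias u p - bias u q\<bar> \<le> int (length u)"
  using occ_append_ge[of u p q] occ_append_le[of u p q]
    occ_append_ge[of u "mirror q" "mirror p"] occ_append_le[of u "mirror q" "mirror p"]
  by (simp add: bias_def)

text \<open>Let \<open>z\<close> be the longest end of \<open>p\<close> whose mirror image begins \<open>q\<close>. If neither word is used up, the
  next two letters are not mirror images, which over two letters means that they are equal.\<close>

lemma cancellation_decomposition:
  "\<exists>x y z. p = x @ z \<and> q = mirror z @ y \<and>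
     (x = [] \<or> y = [] \<or> (\<exists>a x' y'. x = x' @ [a] \<and> y = a # y'))"
proof (induction p arbitrary: q rule: rev_induct)
  case Nil
  show ?case by (rule exI[of _ "[]"], rule exI[of _ q], rule exI[of _ "[]"]) simp
next
  case (snoc a p)
  show ?case
  proof (cases q)
    case Nil
    show ?thesis by (rule exI[of _ "p @ [a]"], rule exI[of _ "[]"], rule exI[of _ "[]"]) (simp add: Nil)
  next
    case (Cons b q')
    show ?thesis
    proof (cases "b = a")
      case True
      show ?thesis by (rule exI[of _ "p @ [a]"], rule exI[of _ q], rule exI[of _ "[]"]) (simp add: Cons True)
    next
      case False
      obtain x y z where xyz: "p = x @ z" "q' = mirror z @ y"
        and xy: "x = [] \<or> y = [] \<or> (\<exists>a x' y'. x = x' @ [a] \<and> y = a # y')"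
        using snoc[of q'] by (elim exE conjE)
      have "p @ [a] = x @ (z @ [a])" "q = mirror (z @ [a]) @ y" using False Cons xyz by simp_all
      then show ?thesis using xy by blast
    qed
  qed
qed

section \<open>Two-by-two integer matrices\<close>

definition M22 :: "int \<Rightarrow> int \<Rightarrow> int \<Rightarrow> int \<Rightarrow> int ^ 2 ^ 2" where
  "M22 a b c d = vector [vector [a, b], vector [c, d]]"

lemma M22_entries [simp]:
  "M22 a b c d $ 1 $ 1 = a" "M22 a b c d $ 1 $ 2 = b"
  "M22 a b c d $ 2 $ 1 = c" "M22 a b c d $ 2 $ 2 = d"
  by (simp_all add: M22_def)

lemma M22_eta: "A = M22 (A $ 1 $ 1) (A $ 1 $ 2) (A $ 2 $ 1) (A $ 2 $ 2)"
  by (simp add: vec_eq_iff forall_2)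

lemma M22_cases [cases type]: obtains a b c d where "A = M22 a b c d"
  using M22_eta by blast

lemma M22_mult [simp]:
  "M22 a b c d ** M22 a' b' c' d' = M22 (a*a'+b*c') (a*b'+b*d') (c*a'+d*c') (c*b'+d*d')"
  by (simp add: vec_eq_iff forall_2 matrix_matrix_mult_def sum_2)

lemma M22_inject [simp]: "M22 a b c d = M22 a' b' c' d' \<longleftrightarrow> a = a' \<and> b = b' \<and> c = c' \<and> d = d'"
  by (auto simp: vec_eq_iff forall_2)

lemma M22_one: "mat 1 = M22 1 0 0 1"
  by (simp add: vec_eq_iff forall_2 mat_def)

lemma M22_det [simp]: "det (M22 a b c d) = a*d - b*c"
  by (simp add: det_2)

lemma M22_trace [simp]: "trace (M22 a b c d) = a + d"
  by (simp add: trace_def sum_2)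

lemma M22_SL2Z [simp]: "M22 a b c d \<in> SL2Z \<longleftrightarrow> a*d - b*c = 1"
  by (simp add: SL2Z_def)

lemma SL2Z_mult [simp]: "A \<in> SL2Z \<Longrightarrow> B \<in> SL2Z \<Longrightarrow> A ** B \<in> SL2Z"
  by (simp add: SL2Z_def det_mul)

lemma SL2Z_one [simp]: "mat 1 \<in> SL2Z"
  by (simp add: M22_one)

text \<open>The inverse on matrices of determinant one; unlike \<open>matrix_inv\<close> it is given by a formula and
  reverses products of arbitrary matrices.\<close>

definition adj :: "int ^ 2 ^ 2 \<Rightarrow> int ^ 2 ^ 2" where
  "adj A = M22 (A $ 2 $ 2) (- A $ 1 $ 2) (- A $ 2 $ 1) (A $ 1 $ 1)"

lemma adj_M22 [simp]: "adj (M22 a b c d) = M22 d (-b) (-c) a"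
  by (simp add: adj_def)

lemma adj_mult: "adj (A ** B) = adj B ** adj A"
  by (cases A; cases B) (simp add: algebra_simps)

lemma adj_adj [simp]: "adj (adj A) = A"
  by (cases A) simp

lemma adj_SL2Z [simp]: "adj A \<in> SL2Z \<longleftrightarrow> A \<in> SL2Z"
  by (cases A) (simp add: algebra_simps)

lemma adj_left [simp]: "A \<in> SL2Z \<Longrightarrow> adj A ** A = mat 1"
  and adj_right [simp]: "A \<in> SL2Z \<Longrightarrow> A ** adj A = mat 1"
  by (cases A; simp add: M22_one algebra_simps)+

lemma adj_left_assoc [simp]: "A \<in> SL2Z \<Longrightarrow> adj A ** (A ** B) = B"
  and adj_right_assoc [simp]: "A \<in> SL2Z \<Longrightarrow> A ** (adj A ** B) = B"
  by (simp_all add: matrix_mul_assoc)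

lemma matrix_inv_SL2Z:
  assumes "A \<in> SL2Z" shows "matrix_inv A = adj A"
proof -
  have inv: "invertible A" using assms unfolding invertible_def by (metis adj_left adj_right)
  have "matrix_inv A ** A = mat 1"
    using someI_ex[OF inv[unfolded invertible_def]] unfolding matrix_inv_def by blast
  then have "matrix_inv A ** A ** adj A = adj A" by simp
  then show ?thesis using assms by (simp flip: matrix_mul_assoc)
qed

section \<open>Products of positive shears\<close>

definition quarter :: "int ^ 2 ^ 2" where "quarter = M22 0 (-1) 1 0"

text \<open>The cyclic group generated by the rotation \<open>quarter\<close>, written out.\<close>

definition quarter_turns :: "(int ^ 2 ^ 2) set" where
  "quarter_turns = {M22 1 0 0 1, M22 0 (-1) 1 0, M22 (-1) 0 0 (-1), M22 0 1 (-1) 0}"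

lemma one_quarter_turns [simp]: "mat 1 \<in> quarter_turns"
  by (simp add: M22_one quarter_turns_def)

lemma quarter_quarter_turns [simp]: "quarter \<in> quarter_turns"
  by (simp add: quarter_turns_def quarter_def)

lemma quarter_turns_mult [simp]: "X \<in> quarter_turns \<Longrightarrow> Y \<in> quarter_turns \<Longrightarrow> X ** Y \<in> quarter_turns"
  by (auto simp: quarter_turns_def)

lemma quarter_turns_adj [simp]: "X \<in> quarter_turns \<Longrightarrow> adj X \<in> quarter_turns"
  by (auto simp: quarter_turns_def)

lemma quarter_turns_SL2Z [simp]: "X \<in> quarter_turns \<Longrightarrow> X \<in> SL2Z"
  by (auto simp: quarter_turns_def)

definition centre :: "(int ^ 2 ^ 2) set" where
  "centre = {M22 1 0 0 1, M22 (-1) 0 0 (-1)}"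

lemma centre_commute: "E \<in> centre \<Longrightarrow> E ** B = B ** E"
  by (cases B) (auto simp: centre_def)

lemma centre_quarter_turns [simp]: "E \<in> centre \<Longrightarrow> E \<in> quarter_turns"
  by (auto simp: centre_def quarter_turns_def)

lemma one_centre [simp]: "mat 1 \<in> centre"
  by (simp add: M22_one centre_def)

lemma centre_mult [simp]: "E \<in> centre \<Longrightarrow> E' \<in> centre \<Longrightarrow> E ** E' \<in> centre"
  by (auto simp: centre_def)

lemma centre_adj [simp]: "E \<in> centre \<Longrightarrow> adj E = E"
  by (auto simp: centre_def)

lemma quarter_turn_mod_centre:
  assumes "X \<in> quarter_turns"
  obtains E where "E \<in> centre" "X = E \<or> X = E ** quarter"
proof -
  have "\<exists>E\<in>centre. X = E \<or> X = E ** quarter"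
    using assms by (auto simp: quarter_turns_def centre_def quarter_def)
  then show thesis using that by blast
qed

definition shear :: "bool \<Rightarrow> int ^ 2 ^ 2" where
  "shear a = (if a then M22 1 1 0 1 else M22 1 0 1 1)"

fun word_matrix :: "bool list \<Rightarrow> int ^ 2 ^ 2" where
  "word_matrix [] = mat 1"
| "word_matrix (a # p) = shear a ** word_matrix p"

lemma word_matrix_append: "word_matrix (p @ q) = word_matrix p ** word_matrix q"
  by (induction p) (simp_all add: matrix_mul_assoc)

lemma word_matrix_SL2Z [simp]: "word_matrix p \<in> SL2Z"
  by (induction p) (simp_all add: shear_def)

text \<open>Together with \<open>shear_merge\<close> this is the whole multiplication table of the modular group in terms of
  words: across a quarter turn, different letters annihilate each other, and equal letters merge into
  one letter of the other kind.\<close>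

lemma shear_cancel: "shear a ** quarter ** shear (\<not> a) = quarter"
  by (simp add: shear_def quarter_def)

lemma shear_merge: "\<exists>E\<in>centre. shear a ** quarter ** shear a = E ** shear (\<not> a)"
  by (cases a) (simp_all add: shear_def quarter_def centre_def)

lemma word_matrix_cancel: "word_matrix p ** quarter ** word_matrix (mirror p) = quarter"
proof (induction p)
  case (Cons a p)
  have "word_matrix (a # p) ** quarter ** word_matrix (mirror (a # p))
      = shear a ** (word_matrix p ** quarter ** word_matrix (mirror p)) ** shear (\<not> a)"
    by (simp add: word_matrix_append matrix_mul_assoc)
  then show ?case using Cons shear_cancel by simp
qed simp

lemma adj_word_matrix: "adj (word_matrix p) = quarter ** word_matrix (mirror p) ** adj quarter"
proof -
  have "adj (word_matrix p) = adj (word_matrix p) ** (quarter ** adj quarter)"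
    by (simp only: adj_right quarter_quarter_turns quarter_turns_SL2Z matrix_mul_rid)
  also have "\<dots> = adj (word_matrix p) ** (word_matrix p ** quarter ** word_matrix (mirror p)) ** adj quarter"
    unfolding word_matrix_cancel by (simp only: matrix_mul_assoc)
  finally show ?thesis by (simp flip: matrix_mul_assoc)
qed

section \<open>Words spelling a matrix\<close>

text \<open>This realises \<open>PSL(2,Z)\<close> as the free product of cyclic groups of orders 2 and 3: the letters
  are the nontrivial elements of order 3, each preceded by the involution. The quarter turns at both
  ends absorb signs and incomplete syllables.\<close>

definition spells :: "bool list \<Rightarrow> int ^ 2 ^ 2 \<Rightarrow> bool" where
  "spells p g \<longleftrightarrow> (\<exists>X\<in>quarter_turns. \<exists>Y\<in>quarter_turns. g = X ** word_matrix p ** Y)"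

lemma spellsI: "X \<in> quarter_turns \<Longrightarrow> Y \<in> quarter_turns \<Longrightarrow> spells p (X ** word_matrix p ** Y)"
  unfolding spells_def by blast

lemma spells_turns:
  assumes "spells p g" "X \<in> quarter_turns" "Y \<in> quarter_turns"
  shows "spells p (X ** g ** Y)"
proof -
  obtain U V where "U \<in> quarter_turns" "V \<in> quarter_turns" "g = U ** word_matrix p ** V"
    using assms(1) unfolding spells_def by blast
  then have "X ** g ** Y = (X ** U) ** word_matrix p ** (V ** Y)" by (simp add: matrix_mul_assoc)
  then show ?thesis using spellsI assms \<open>U \<in> _\<close> \<open>V \<in> _\<close> by simp
qed

lemma spells_word_matrix: "spells p (word_matrix p)"
  using spellsI[of "mat 1" "mat 1" p] by simp

text \<open>The inverse of a word is its mirror image conjugated by a quarter turn, which the definition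
  absorbs.\<close>

lemma spells_adj: "spells p g \<Longrightarrow> spells (mirror p) (adj g)"
proof -
  assume "spells p g"
  then obtain X Y where *: "X \<in> quarter_turns" "Y \<in> quarter_turns" "g = X ** word_matrix p ** Y"
    unfolding spells_def by blast
  have "adj g = (adj Y ** quarter) ** word_matrix (mirror p) ** (adj quarter ** adj X)"
    by (simp add: * adj_mult adj_word_matrix matrix_mul_assoc)
  then show ?thesis using spellsI * by simp
qed

text \<open>The estimate for a product passes six junctions of words, each of cost at most \<open>length u\<close>, and
  three single letters.\<close>

definition defect :: "bool list \<Rightarrow> int" where
  "defect u = 6 * int (length u) + 3"

lemma defect_nonneg [simp]: "defect u \<ge> 0"
  by (simp add: defect_def)

text \<open>Writing \<open>p = x @ z\<close> and \<open>q = mirror z @ y\<close> with \<open>z\<close> maximal, the matrices of \<open>z\<close> and \<open>mirror z\<close> cancel and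
  the count loses \<open>bias u z + bias u (mirror z) = 0\<close>. What is left is a word, up to replacing the two
  equal letters at the junction by one letter.\<close>

lemma spells_quarter_product:
  "\<exists>r. spells r (word_matrix p ** quarter ** word_matrix q) \<and>
       \<bar>bias u r - bias u p - bias u q\<bar> \<le> 6 * int (length u) + 3"
proof -
  obtain x y z where p: "p = x @ z" and q: "q = mirror z @ y"
    and xy: "x = [] \<or> y = [] \<or> (\<exists>a x' y'. x = x' @ [a] \<and> y = a # y')"
    using cancellation_decomposition[of p q] by (elim exE conjE)
  have eq: "word_matrix p ** quarter ** word_matrix q = word_matrix x ** quarter ** word_matrix y"
  proof -
    have "word_matrix p ** quarter ** word_matrix q
       = word_matrix x ** (word_matrix z ** quarter ** word_matrix (mirror z)) ** word_matrix y"
      by (simp add: p q word_matrix_append matrix_mul_assoc)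
    then show ?thesis by (simp add: word_matrix_cancel)
  qed
  have b: "\<bar>bias u p + bias u q - bias u x - bias u y\<bar> \<le> 2 * int (length u)"
    using bias_append[of u x z] bias_append[of u "mirror z" y] by (simp add: p q)
  from xy consider "x = []" | "y = []" | a x' y' where "x = x' @ [a]" "y = a # y'" by blast
  then show ?thesis
  proof cases
    case 1
    then have "spells y (word_matrix p ** quarter ** word_matrix q)"
      using spellsI[of quarter "mat 1" y] by (simp add: eq)
    moreover have "\<bar>bias u y - bias u p - bias u q\<bar> \<le> 6 * int (length u) + 3" using b 1 by simp
    ultimately show ?thesis by blast
  next
    case 2
    then have "spells x (word_matrix p ** quarter ** word_matrix q)"
      using spellsI[of "mat 1" quarter x] by (simp add: eq)
    moreover have "\<bar>bias u x - bias u p - bias u q\<bar> \<le> 6 * int (length u) + 3" using b 2 by simp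
    ultimately show ?thesis by blast
  next
    case 3
    obtain E where E: "E \<in> centre" "shear a ** quarter ** shear a = E ** shear (\<not> a)" using shear_merge by blast
    have "word_matrix x ** quarter ** word_matrix y
        = word_matrix x' ** (shear a ** quarter ** shear a) ** word_matrix y'"
      by (simp add: 3 word_matrix_append matrix_mul_assoc)
    also have "\<dots> = (word_matrix x' ** E) ** shear (\<not> a) ** word_matrix y'"
      unfolding E(2) by (simp only: matrix_mul_assoc)
    also have "word_matrix x' ** E = E ** word_matrix x'" using centre_commute[OF E(1)] by simp
    finally have "word_matrix x ** quarter ** word_matrix y = E ** word_matrix (x' @ [\<not> a] @ y')"
      by (simp add: word_matrix_append matrix_mul_assoc)
    then have "spells (x' @ [\<not> a] @ y') (word_matrix p ** quarter ** word_matrix q)"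
      using spellsI[of E "mat 1"] E(1) by (simp add: eq)
    moreover have "\<bar>bias u (x' @ [\<not> a] @ y') - bias u x - bias u y\<bar> \<le> 4 * int (length u) + 3"
      using bias_append[of u x' "[\<not> a] @ y'"] bias_append[of u "[\<not> a]" y']
        bias_append[of u x' "[a]"] bias_append[of u "[a]" y']
        bias_singleton[of u a] bias_singleton[of u "\<not> a"]
      by (simp add: 3)
    moreover from this b have "\<bar>bias u (x' @ [\<not> a] @ y') - bias u p - bias u q\<bar> \<le> 6 * int (length u) + 3"
      by linarith
    ultimately show ?thesis by blast
  qed
qed

text \<open>Between the two words stands a quarter turn. Up to sign it is either trivial, and the words are
  simply concatenated, or it is the rotation treated in \<open>spells_quarter_product\<close>.\<close>

lemma spells_product:
  assumes "spells p g" "spells q g'"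
  shows "\<exists>r. spells r (g ** g') \<and> \<bar>bias u r - bias u p - bias u q\<bar> \<le> 6 * int (length u) + 3"
proof -
  obtain X Y where *: "X \<in> quarter_turns" "Y \<in> quarter_turns" "g = X ** word_matrix p ** Y"
    using assms(1) unfolding spells_def by blast
  obtain U V where **: "U \<in> quarter_turns" "V \<in> quarter_turns" "g' = U ** word_matrix q ** V"
    using assms(2) unfolding spells_def by blast
  obtain E where E: "E \<in> centre" "Y ** U = E \<or> Y ** U = E ** quarter"
    using quarter_turn_mod_centre[of "Y ** U"] * ** by auto
  have split: "g ** g' = X ** (word_matrix p ** (Y ** U) ** word_matrix q) ** V"
    by (simp add: * ** matrix_mul_assoc)
  have comm: "X ** (word_matrix p ** (E ** Z) ** word_matrix q) ** V
      = (X ** E) ** (word_matrix p ** Z ** word_matrix q) ** V" for Z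
  proof -
    have "X ** (word_matrix p ** (E ** Z) ** word_matrix q) ** V
        = X ** (word_matrix p ** E) ** Z ** word_matrix q ** V" by (simp only: matrix_mul_assoc)
    also have "word_matrix p ** E = E ** word_matrix p" by (rule centre_commute[OF E(1), symmetric])
    finally show ?thesis by (simp only: matrix_mul_assoc)
  qed
  from E(2) show ?thesis
  proof
    assume "Y ** U = E"
    then have "g ** g' = (X ** E) ** word_matrix (p @ q) ** V"
      using split comm[of "mat 1"] by (simp add: word_matrix_append)
    then have "spells (p @ q) (g ** g')" using spellsI * ** E(1) by simp
    then show ?thesis using bias_append[of u p q] by (intro exI[of _ "p @ q"]) auto
  next
    assume "Y ** U = E ** quarter"
    then have eq: "g ** g' = (X ** E) ** (word_matrix p ** quarter ** word_matrix q) ** V"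
      using split comm[of quarter] by simp
    show ?thesis
      using spells_quarter_product[of p q u] spells_turns[of _ _ "X ** E" V] * ** E(1)
      unfolding eq by auto
  qed
qed

definition entry_sum :: "int ^ 2 ^ 2 \<Rightarrow> int" where
  "entry_sum A = \<bar>A $ 1 $ 1\<bar> + \<bar>A $ 1 $ 2\<bar> + \<bar>A $ 2 $ 1\<bar> + \<bar>A $ 2 $ 2\<bar>"

lemma entry_sum_turns:
  "X \<in> quarter_turns \<Longrightarrow> entry_sum (X ** A) = entry_sum A"
  "X \<in> quarter_turns \<Longrightarrow> entry_sum (A ** X) = entry_sum A"
  by (cases A; auto simp: quarter_turns_def entry_sum_def)+

lemma entry_sum_spells: "spells p g \<Longrightarrow> entry_sum g = entry_sum (word_matrix p)"
  by (auto simp: spells_def entry_sum_turns)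

fun alternations :: "bool list \<Rightarrow> nat" where
  "alternations (a # b # p) = (if a = b then 0 else 1) + alternations (b # p)"
| "alternations _ = 0"

text \<open>A letter \<open>x\<close> adds one row to the other, so after it the row that was increased dominates. If the
  next letter is different, it adds the dominating row to the smaller one, and the sum of all entries
  grows by a factor of at least 3/2. Runs of equal letters only give linear growth, which is why
  alternations are counted.\<close>

lemma word_matrix_growth:
  assumes "word_matrix p = M22 a b c d"
  shows "a \<ge> 0 \<and> b \<ge> 0 \<and> c \<ge> 0 \<and> d \<ge> 0 \<and> a + b \<ge> 1 \<and> c + d \<ge> 1 \<and>
    a + b + c + d \<ge> 2 + int (length p) \<and>
    real_of_int (a + b + c + d) \<ge> 2 * (3/2) ^ alternations p \<and>
    (\<forall>x q. p = x # q \<longrightarrow> (if x then a + b \<ge> c + d else a + b \<le> c + d))"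
  using assms
proof (induction p arbitrary: a b c d)
  case (Cons x p)
  obtain a' b' c' d' where m: "word_matrix p = M22 a' b' c' d'" by (cases "word_matrix p")
  note IH = Cons.IH[OF m]
  have e: "a = (if x then a' + c' else a')" "b = (if x then b' + d' else b')"
     "c = (if x then c' else a' + c')" "d = (if x then d' else b' + d')"
    using Cons.prems by (auto simp: m shear_def)
  have "real_of_int (a + b + c + d) \<ge> 2 * (3/2) ^ alternations (x # p)"
  proof (cases "\<exists>y q. p = y # q \<and> y \<noteq> x")
    case True
    then obtain q where q: "p = (\<not> x) # q" by auto
    have "2 * real_of_int (a + b + c + d) \<ge> 3 * real_of_int (a' + b' + c' + d')"
      using IH q by (auto simp: e split: if_splits)
    then show ?thesis using IH q by simp
  next
    case False
    then have "alternations (x # p) = alternations p" by (cases p) auto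
    moreover have "a + b + c + d \<ge> a' + b' + c' + d'" using IH by (auto simp: e)
    ultimately show ?thesis using IH by (simp flip: of_int_add)
  qed
  then show ?case using IH by (cases x) (simp_all add: e)
qed (simp add: M22_one)

lemma entry_sum_word_matrix:
  "entry_sum (word_matrix p) \<ge> 2 + int (length p)"
  "real_of_int (entry_sum (word_matrix p)) \<ge> 2 * (3/2) ^ alternations p"
proof -
  obtain a b c d where m: "word_matrix p = M22 a b c d" by (cases "word_matrix p")
  show "entry_sum (word_matrix p) \<ge> 2 + int (length p)"
    "real_of_int (entry_sum (word_matrix p)) \<ge> 2 * (3/2) ^ alternations p"
    using word_matrix_growth[OF m] by (auto simp: m entry_sum_def)
qed

text \<open>If two words spell the same matrix, the product of the inverse of one with the other is the
  identity, whose only word is empty because every letter increases the sum of the entries. Thus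
  additivity up to the defect already shows that the count depends on the word only up to the
  defect, and a normal form theorem can be avoided.\<close>

lemma spells_bias_unique:
  assumes "spells p g" "spells q g" "g \<in> SL2Z"
  shows "\<bar>bias u p - bias u q\<bar> \<le> 6 * int (length u) + 3"
proof -
  obtain r where r: "spells r (adj g ** g)"
    "\<bar>bias u r - bias u (mirror p) - bias u q\<bar> \<le> 6 * int (length u) + 3"
    using spells_product[OF spells_adj[OF assms(1)] assms(2)] by blast
  have "entry_sum (word_matrix r) = 2"
    using entry_sum_spells[OF r(1)] assms(3) by (simp add: M22_one entry_sum_def)
  then have "r = []" using entry_sum_word_matrix(1)[of r] by simp
  then show ?thesis using r(2) by simp
qed

text \<open>The Euclidean algorithm on rows. With determinant one and nonnegative entries, one row dominates
  the other unless the matrix is the identity; subtracting the smaller row strips off a letter.\<close>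

lemma nonneg_is_word:
  assumes "a \<ge> 0" "b \<ge> 0" "c \<ge> 0" "d \<ge> 0" "a * d - b * c = 1"
  shows "\<exists>p. M22 a b c d = word_matrix p"
  using assms
proof (induction "nat (a + b + c + d)" arbitrary: a b c d rule: less_induct)
  case less
  have "\<not> (c = 0 \<and> d = 0)" "\<not> (a = 0 \<and> b = 0)" using less.prems by auto
  then have nz: "c + d > 0" "a + b > 0" using less.prems by linarith+
  consider "a \<ge> c" "b \<ge> d" | "a \<le> c" "b \<le> d" | "a > c" "b < d" | "a < c" "b > d" by linarith
  then show ?case
  proof cases
    case 1
    have "\<exists>p. M22 (a - c) (b - d) c d = word_matrix p"
      by (rule less.hyps) (use less.prems 1 nz in \<open>auto simp: algebra_simps\<close>)
    then obtain p where "M22 (a - c) (b - d) c d = word_matrix p" by blast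
    then have "M22 a b c d = word_matrix (True # p)" by (simp add: shear_def flip: \<open>_ = word_matrix p\<close>)
    then show ?thesis by blast
  next
    case 2
    have "\<exists>p. M22 a b (c - a) (d - b) = word_matrix p"
      by (rule less.hyps) (use less.prems 2 nz in \<open>auto simp: algebra_simps\<close>)
    then obtain p where "M22 a b (c - a) (d - b) = word_matrix p" by blast
    then have "M22 a b c d = word_matrix (False # p)" by (simp add: shear_def flip: \<open>_ = word_matrix p\<close>)
    then show ?thesis by blast
  next
    case 3
    have "(c + 1) * (b + 1) \<le> a * d" using 3 less.prems by (intro mult_mono) auto
    then have bc: "b = 0" "c = 0" using less.prems by (auto simp: algebra_simps)
    then have "a * d = 1" using less.prems by simp
    then have "a = 1" "d = 1" using less.prems by (auto simp: zmult_eq_1_iff)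
    then have "M22 a b c d = word_matrix []" using bc by (simp add: M22_one)
    then show ?thesis by blast
  next
    case 4
    have "a * d \<le> (c - 1) * (b - 1)" using 4 less.prems by (intro mult_mono) auto
    then show ?thesis using 4 less.prems by (auto simp: algebra_simps)
  qed
qed

text \<open>As the products \<open>x * w\<close> and \<open>y * z\<close> differ by one, they do not have strictly opposite signs. This
  leaves eight sign patterns, each of which becomes nonnegative under multiplication by suitable
  quarter turns.\<close>

lemma nonneg_turn:
  assumes "g \<in> SL2Z"
  obtains X Y a b c d where "X \<in> quarter_turns" "Y \<in> quarter_turns"
    "X ** g ** Y = M22 a b c d" "a \<ge> 0" "b \<ge> 0" "c \<ge> 0" "d \<ge> 0"
proof -
  obtain x y z w where g: "g = M22 x y z w" by (cases g)
  have det: "x * w - y * z = 1" using assms g by simp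
  let ?I = "M22 1 0 0 1" and ?J = "M22 (-1) 0 0 (-1)" and ?S = "M22 0 (-1) 1 0" and ?T = "M22 0 1 (-1) 0"
  have t: "?I \<in> quarter_turns" "?J \<in> quarter_turns" "?S \<in> quarter_turns" "?T \<in> quarter_turns"
    by (simp_all add: quarter_turns_def)
  consider "x \<ge> 0" "y \<ge> 0" "z \<ge> 0" "w \<ge> 0" | "x \<le> 0" "y \<le> 0" "z \<le> 0" "w \<le> 0"
    | "x \<ge> 0" "y \<le> 0" "z \<le> 0" "w \<ge> 0" | "x \<le> 0" "y \<ge> 0" "z \<ge> 0" "w \<le> 0"
    | "x \<ge> 0" "y \<ge> 0" "z \<le> 0" "w \<le> 0" | "x \<le> 0" "y \<le> 0" "z \<ge> 0" "w \<ge> 0"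
    | "x \<ge> 0" "y \<le> 0" "z \<ge> 0" "w \<le> 0" | "x \<le> 0" "y \<ge> 0" "z \<le> 0" "w \<ge> 0"
  proof -
    have "0 \<le> x * w \<and> 0 \<le> y * z \<or> x * w \<le> 0 \<and> y * z \<le> 0" using det by linarith
    then show ?thesis using that unfolding zero_le_mult_iff mult_le_0_iff by blast
  qed
  then show thesis
  proof cases
    case 1 show thesis by (rule that[OF t(1) t(1), of "x" "y" "z" "w"]) (use 1 g in simp_all)
  next
    case 2 show thesis by (rule that[OF t(1) t(2), of "-x" "-y" "-z" "-w"]) (use 2 g in simp_all)
  next
    case 3 show thesis by (rule that[OF t(3) t(4), of "w" "-z" "-y" "x"]) (use 3 g in simp_all)
  next
    case 4 show thesis by (rule that[OF t(3) t(3), of "-w" "z" "y" "-x"]) (use 4 g in simp_all)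
  next
    case 5 show thesis by (rule that[OF t(3) t(1), of "-z" "-w" "x" "y"]) (use 5 g in simp_all)
  next
    case 6 show thesis by (rule that[OF t(4) t(1), of "z" "w" "-x" "-y"]) (use 6 g in simp_all)
  next
    case 7 show thesis by (rule that[OF t(1) t(4), of "-y" "x" "-w" "z"]) (use 7 g in simp_all)
  next
    case 8 show thesis by (rule that[OF t(1) t(3), of "y" "-x" "w" "-z"]) (use 8 g in simp_all)
  qed
qed

lemma ex_spells:
  assumes "g \<in> SL2Z" shows "\<exists>p. spells p g"
proof -
  obtain X Y a b c d where *: "X \<in> quarter_turns" "Y \<in> quarter_turns"
    "X ** g ** Y = M22 a b c d" "a \<ge> 0" "b \<ge> 0" "c \<ge> 0" "d \<ge> 0"
    using nonneg_turn[OF assms] .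
  have "X ** g ** Y \<in> SL2Z" using *(1,2) assms by simp
  then have "a * d - b * c = 1" unfolding *(3) by simp
  then obtain p where "X ** g ** Y = word_matrix p" using nonneg_is_word * by metis
  then have "spells p (adj X ** (X ** g ** Y) ** adj Y)"
    using spellsI[of "adj X" "adj Y" p] * by simp
  moreover have "adj X ** (X ** g ** Y) ** adj Y = g"
    using *(1,2) by (simp flip: matrix_mul_assoc)
  ultimately show ?thesis by auto
qed

section \<open>The counting quasimorphism\<close>

text \<open>The choice of the word affects the value by at most the defect, by \<open>spells_bias_unique\<close>.\<close>

definition brooks :: "bool list \<Rightarrow> int ^ 2 ^ 2 \<Rightarrow> int" where
  "brooks u g = bias u (SOME p. spells p g)"

lemma brooks_word:
  assumes "g \<in> SL2Z"
  obtains p where "spells p g" "brooks u g = bias u p"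
  using someI_ex[OF ex_spells[OF assms]] unfolding brooks_def by blast

lemma brooks_spells:
  assumes "g \<in> SL2Z" "spells p g"
  shows "\<bar>brooks u g - bias u p\<bar> \<le> defect u"
  using brooks_word[OF assms(1)] spells_bias_unique[OF _ assms(2,1)] unfolding defect_def by metis

lemma brooks_mult:
  assumes "g \<in> SL2Z" "g' \<in> SL2Z"
  shows "\<bar>brooks u (g ** g') - brooks u g - brooks u g'\<bar> \<le> 2 * defect u"
proof -
  obtain p q where p: "spells p g" "brooks u g = bias u p" and q: "spells q g'" "brooks u g' = bias u q"
    using assms brooks_word by metis
  obtain r where r: "spells r (g ** g')" "\<bar>bias u r - bias u p - bias u q\<bar> \<le> defect u"
    using spells_product[OF p(1) q(1)] unfolding defect_def by blast
  show ?thesis using brooks_spells[OF _ r(1), of u] assms r(2) p(2) q(2) by simp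
qed

lemma brooks_adj:
  assumes "g \<in> SL2Z"
  shows "\<bar>brooks u (adj g) + brooks u g\<bar> \<le> defect u"
proof -
  obtain p where p: "spells p g" "brooks u g = bias u p" using brooks_word[OF assms] .
  show ?thesis using brooks_spells[OF _ spells_adj[OF p(1)], of u] assms p(2) by simp
qed

lemma brooks_conjugate:
  assumes "g \<in> SL2Z" "A \<in> SL2Z"
  shows "\<bar>brooks u (g ** A ** adj g) - brooks u A\<bar> \<le> 5 * defect u"
  using brooks_mult[of "g ** A" "adj g" u] brooks_mult[of g A u] brooks_adj[of g u] assms by simp

section \<open>Hyperbolic matrices and their powers\<close>

lemma conjugate_SL2Z_iff: "conjugate_SL2Z A B \<longleftrightarrow> (\<exists>g\<in>SL2Z. B = g ** A ** adj g)"
  unfolding conjugate_SL2Z_def by (metis matrix_inv_SL2Z)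

lemma conjugate_SL2Z_refl: "conjugate_SL2Z A A"
  unfolding conjugate_SL2Z_iff by (rule bexI[of _ "mat 1"]) (simp_all add: M22_one flip: M22_one)

lemma conjugate_SL2Z_sym: "conjugate_SL2Z A B \<Longrightarrow> conjugate_SL2Z B A"
proof -
  assume "conjugate_SL2Z A B"
  then obtain g where g: "g \<in> SL2Z" "B = g ** A ** adj g" unfolding conjugate_SL2Z_iff by blast
  then have "A = adj g ** B ** adj (adj g)" by (simp flip: matrix_mul_assoc)
  then show ?thesis using g unfolding conjugate_SL2Z_iff by (metis adj_SL2Z)
qed

lemma conjugate_SL2Z_trans: "conjugate_SL2Z A B \<Longrightarrow> conjugate_SL2Z B C \<Longrightarrow> conjugate_SL2Z A C"
proof -
  assume "conjugate_SL2Z A B" "conjugate_SL2Z B C"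
  then obtain g k where g: "g \<in> SL2Z" "k \<in> SL2Z" "B = g ** A ** adj g" "C = k ** B ** adj k"
    unfolding conjugate_SL2Z_iff by blast
  then have "C = (k ** g) ** A ** adj (k ** g)" by (simp add: adj_mult matrix_mul_assoc)
  then show ?thesis using g unfolding conjugate_SL2Z_iff by (metis SL2Z_mult)
qed

lemma conjugate_SL2Z_trace:
  assumes "conjugate_SL2Z A B" shows "trace B = trace A"
proof -
  obtain g where g: "g \<in> SL2Z" "B = g ** A ** adj g" using assms unfolding conjugate_SL2Z_iff by blast
  have "trace B = trace (adj g ** (g ** A))" unfolding g(2) by (rule trace_mul_sym)
  then show ?thesis using g(1) by simp
qed

lemma conjugate_SL2Z_centre:
  assumes "conjugate_SL2Z A B" "E \<in> centre" shows "conjugate_SL2Z (E ** A) (E ** B)"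
proof -
  obtain g where g: "g \<in> SL2Z" "B = g ** A ** adj g" using assms unfolding conjugate_SL2Z_iff by blast
  have "g ** (E ** A) ** adj g = (g ** E) ** A ** adj g" by (simp only: matrix_mul_assoc)
  also have "g ** E = E ** g" using centre_commute[OF assms(2)] by simp
  finally have "E ** B = g ** (E ** A) ** adj g" unfolding g(2) by (simp only: matrix_mul_assoc)
  then show ?thesis using g(1) unfolding conjugate_SL2Z_iff by blast
qed

lemma conjugate_SL2Z_adj:
  assumes "conjugate_SL2Z A B" shows "conjugate_SL2Z (adj A) (adj B)"
proof -
  obtain g where g: "g \<in> SL2Z" "B = g ** A ** adj g" using assms unfolding conjugate_SL2Z_iff by blast
  then have "adj B = g ** adj A ** adj g" by (simp add: adj_mult matrix_mul_assoc)
  then show ?thesis using g(1) unfolding conjugate_SL2Z_iff by blast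
qed

lemma conjugate_SL2Z_swap:
  assumes "A \<in> SL2Z" "B \<in> SL2Z" shows "conjugate_SL2Z (A ** B) (B ** A)"
proof -
  have "B ** A = B ** (A ** B) ** adj B" using assms by (simp flip: matrix_mul_assoc)
  then show ?thesis using assms unfolding conjugate_SL2Z_iff by blast
qed

text \<open>A word with a quarter turn in front is cyclically reduced by moving its last letter to the front,
  across the quarter turn. Either the two end letters annihilate each other and the word becomes
  shorter, or they merge and the quarter turn disappears. Words with at most one letter give
  elliptic matrices, which the bound on the trace excludes.\<close>

lemma quarter_word_conjugate:
  assumes "E \<in> centre" "\<bar>trace (E ** quarter ** word_matrix p)\<bar> > 2"
  shows "\<exists>E'\<in>centre. \<exists>r. conjugate_SL2Z (E ** quarter ** word_matrix p) (E' ** word_matrix r)"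
  using assms(2)
proof (induction p rule: length_induct)
  case (1 p)
  have tr: "\<bar>trace (E ** quarter ** word_matrix q)\<bar> \<le> 1" if "q = [] \<or> (\<exists>a. q = [a])" for q
    using that assms(1) by (auto simp: centre_def M22_one quarter_def shear_def)
  obtain x r y where p: "p = x # r @ [y]"
  proof (cases p)
    case Nil then show ?thesis using tr[of p] 1 by auto
  next
    case (Cons x q)
    then show ?thesis using that tr[of p] 1 by (cases q rule: rev_cases) auto
  qed
  have s: "quarter \<in> SL2Z" "shear a \<in> SL2Z" "E \<in> SL2Z" for a
    using assms(1) by (simp_all add: shear_def)
  have "E ** quarter ** word_matrix p = E ** (quarter ** shear x ** word_matrix r) ** shear y"
    by (simp add: p word_matrix_append matrix_mul_assoc)
  moreover have "conjugate_SL2Z (E ** (quarter ** shear x ** word_matrix r) ** shear y)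
     (shear y ** (E ** (quarter ** shear x ** word_matrix r)))"
    by (rule conjugate_SL2Z_swap) (simp_all add: s)
  moreover have "shear y ** (E ** (quarter ** shear x ** word_matrix r))
     = (shear y ** E) ** quarter ** shear x ** word_matrix r" by (simp only: matrix_mul_assoc)
  moreover have "shear y ** E = E ** shear y" using centre_commute[OF assms(1)] by simp
  ultimately have conj: "conjugate_SL2Z (E ** quarter ** word_matrix p)
      (E ** (shear y ** quarter ** shear x) ** word_matrix r)" by (simp add: matrix_mul_assoc)
  show ?case
  proof (cases "x = y")
    case True
    obtain E' where E': "E' \<in> centre" "shear x ** quarter ** shear x = E' ** shear (\<not> x)"
      using shear_merge by blast
    have "E ** (shear y ** quarter ** shear x) ** word_matrix r
        = (E ** E') ** word_matrix ((\<not> x) # r)"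
      using E' True by (simp add: matrix_mul_assoc)
    then show ?thesis using conj E' assms(1) by (metis centre_mult)
  next
    case False
    then have "x = (\<not> y)" by auto
    then have eq: "E ** (shear y ** quarter ** shear x) ** word_matrix r = E ** quarter ** word_matrix r"
      using shear_cancel[of y] by simp
    have c: "conjugate_SL2Z (E ** quarter ** word_matrix p) (E ** quarter ** word_matrix r)"
      using conj unfolding eq .
    then have "\<bar>trace (E ** quarter ** word_matrix r)\<bar> > 2"
      using 1(2) c conjugate_SL2Z_trace by simp
    moreover have "length r < length p" by (simp add: p)
    ultimately obtain E' q where "E' \<in> centre" "conjugate_SL2Z (E ** quarter ** word_matrix r) (E' ** word_matrix q)"
      using 1(1) by blast
    then show ?thesis using conjugate_SL2Z_trans[OF c] by blast
  qed
qed

lemma hyperbolic_conjugate_word: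
  assumes "h \<in> SL2Z" "hyperbolic h"
  obtains E r where "E \<in> centre" "conjugate_SL2Z h (E ** word_matrix r)"
proof -
  obtain p where "spells p h" using ex_spells[OF assms(1)] by blast
  then obtain X Y where XY: "X \<in> quarter_turns" "Y \<in> quarter_turns" "h = X ** word_matrix p ** Y"
    unfolding spells_def by blast
  have c: "conjugate_SL2Z h ((Y ** X) ** word_matrix p)"
    using conjugate_SL2Z_swap[of "X ** word_matrix p" Y] XY by (simp add: matrix_mul_assoc)
  obtain E where E: "E \<in> centre" "Y ** X = E \<or> Y ** X = E ** quarter"
    using quarter_turn_mod_centre[of "Y ** X"] XY by auto
  from E(2) show thesis
  proof
    assume "Y ** X = E" then show thesis using that E(1) c by metis
  next
    assume "Y ** X = E ** quarter"
    then have c': "conjugate_SL2Z h (E ** quarter ** word_matrix p)" using c by simp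
    then have "\<bar>trace (E ** quarter ** word_matrix p)\<bar> > 2"
      using assms(2) conjugate_SL2Z_trace unfolding hyperbolic_def by metis
    then show thesis using quarter_word_conjugate[OF E(1)] that c' conjugate_SL2Z_trans by blast
  qed
qed

lemma conjugate_rotate: "conjugate_SL2Z (word_matrix (x @ y)) (word_matrix (y @ x))"
  unfolding word_matrix_append by (rule conjugate_SL2Z_swap) simp_all

lemma no_alternation: "alternations p = 0 \<Longrightarrow> \<exists>n a. p = replicate n a"
proof (induction p rule: alternations.induct)
  case (1 a b p)
  then obtain n c where "b # p = replicate n c" by (auto split: if_splits)
  moreover have "a = b" using 1(2) by (auto split: if_splits)
  ultimately have "a # b # p = replicate (Suc n) a" by (cases n) auto
  then show ?case by blast
qed (auto intro: exI[of _ 0] exI[of _ "Suc 0"])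

lemma word_matrix_replicate:
  "word_matrix (replicate n a) = (if a then M22 1 (int n) 0 1 else M22 1 0 (int n) 1)"
  by (induction n) (auto simp: M22_one shear_def)

lemma alternation_split: "alternations p > 0 \<Longrightarrow> \<exists>x a y. p = x @ a # (\<not> a) # y"
proof (induction p rule: alternations.induct)
  case (1 a b p)
  show ?case
  proof (cases "a = b")
    case True
    then obtain x c y where "b # p = x @ c # (\<not> c) # y" using 1 by auto
    then have "a # b # p = (a # x) @ c # (\<not> c) # y" by simp
    then show ?thesis by blast
  next
    case False
    then have "a # b # p = [] @ a # (\<not> a) # p" by auto
    then show ?thesis by blast
  qed
qed auto

text \<open>A word with only one letter gives a unipotent matrix, of trace 2. So both letters occur, and a
  cyclic rotation puts a change of letters in front. With such a pattern an occurrence begins with a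
  change of letters, so it can be charged to the alternation at its first position.\<close>

lemma hyperbolic_conjugate_alternating_word:
  assumes "h \<in> SL2Z" "hyperbolic h"
  obtains E a v where "E \<in> centre" "conjugate_SL2Z h (E ** word_matrix (a # (\<not> a) # v))"
proof -
  obtain E r where E: "E \<in> centre" and c: "conjugate_SL2Z h (E ** word_matrix r)"
    using hyperbolic_conjugate_word[OF assms] .
  have "alternations r > 0"
  proof (rule ccontr)
    assume "\<not> ?thesis"
    then have "alternations r = 0" by simp
    then obtain n a where "r = replicate n a" using no_alternation by blast
    then have "\<bar>trace (E ** word_matrix r)\<bar> \<le> 2"
      using E by (auto simp: centre_def word_matrix_replicate)
    then show False using conjugate_SL2Z_trace[OF c] assms(2) by (simp add: hyperbolic_def)
  qed
  then obtain x a y where r: "r = x @ a # (\<not> a) # y" using alternation_split by blast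
  have "conjugate_SL2Z h (E ** word_matrix ((a # (\<not> a) # y) @ x))"
    using conjugate_SL2Z_trans[OF c[unfolded r] conjugate_SL2Z_centre[OF conjugate_rotate E]] .
  then show thesis using that[OF E, of a "y @ x"] by simp
qed

lemma occ_le_alternations: "occ (a # (\<not> a) # v) p \<le> alternations p"
proof (induction p)
  case (Cons x p)
  then show ?case by (cases p) auto
qed simp

text \<open>Occurrences are bounded by alternations, and alternations make the entries grow exponentially.\<close>

lemma occ_le_entry_sum:
  "2 * (3/2) ^ occ (a # (\<not> a) # v) p \<le> real_of_int (entry_sum (word_matrix p))"
proof -
  have "(3/2::real) ^ occ (a # (\<not> a) # v) p \<le> (3/2) ^ alternations p"
    by (rule power_increasing[OF occ_le_alternations]) simp
  then show ?thesis using entry_sum_word_matrix(2)[of p] by linarith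
qed

lemma entry_sum_adj [simp]: "entry_sum (adj A) = entry_sum A"
  by (cases A) (simp add: entry_sum_def)

text \<open>The quasimorphism is at most logarithmic in the size of the matrix; quarter turns permute the
  entries up to sign, so the word and its matrix have the same sum of entries.\<close>

lemma brooks_growth:
  assumes "g \<in> SL2Z"
  shows "2 * (3/2) powr \<bar>real_of_int (brooks (a # (\<not> a) # v) g)\<bar> \<le> real_of_int (entry_sum g)"
proof -
  let ?u = "a # (\<not> a) # v"
  obtain p where p: "spells p g" "brooks ?u g = bias ?u p" using brooks_word[OF assms] .
  define m where "m = max (occ ?u p) (occ ?u (mirror p))"
  have "\<bar>real_of_int (bias ?u p)\<bar> \<le> real m" by (simp add: m_def bias_def)
  then have "(3/2) powr \<bar>real_of_int (bias ?u p)\<bar> \<le> (3/2::real) ^ m"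
    by (simp flip: powr_realpow)
  moreover have "2 * (3/2) ^ m \<le> real_of_int (entry_sum g)"
    using occ_le_entry_sum[of a v p] occ_le_entry_sum[of a v "mirror p"]
      entry_sum_spells[OF p(1)] entry_sum_spells[OF spells_adj[OF p(1)]]
    by (auto simp: m_def max_def)
  ultimately show ?thesis using p(2) by simp
qed

lemma spells_power:
  assumes "E \<in> centre"
  shows "spells (concat (replicate t r)) (matrix_power (E ** word_matrix r) t)"
proof -
  have "\<exists>E'\<in>centre. matrix_power (E ** word_matrix r) t = E' ** word_matrix (concat (replicate t r))"
  proof (induction t)
    case (Suc t)
    then obtain E' where E': "E' \<in> centre"
      "matrix_power (E ** word_matrix r) t = E' ** word_matrix (concat (replicate t r))" by blast
    have "E ** word_matrix r ** (E' ** word_matrix (concat (replicate t r)))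
       = E ** (word_matrix r ** E') ** word_matrix (concat (replicate t r))"
      by (simp only: matrix_mul_assoc)
    also have "word_matrix r ** E' = E' ** word_matrix r" using centre_commute[OF E'(1)] by simp
    finally have "matrix_power (E ** word_matrix r) (Suc t)
       = (E ** E') ** word_matrix (concat (replicate (Suc t) r))"
      using E' by (simp add: word_matrix_append matrix_mul_assoc)
    then show ?case using E'(1) assms by (metis centre_mult)
  qed (auto intro!: bexI[of _ "mat 1"])
  then show ?thesis using spellsI[of _ "mat 1"] by auto
qed

lemma matrix_power_conjugate:
  assumes "g \<in> SL2Z"
  shows "matrix_power (g ** A ** adj g) t = g ** matrix_power A t ** adj g"
  by (induction t) (use assms in \<open>simp_all flip: matrix_mul_assoc\<close>)

lemma matrix_power_SL2Z [simp]: "A \<in> SL2Z \<Longrightarrow> matrix_power A t \<in> SL2Z"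
  by (induction t) simp_all

lemma occ_concat_replicate: "u \<noteq> [] \<Longrightarrow> t \<le> occ u (concat (replicate t u))"
proof (induction t)
  case (Suc t)
  have "1 \<le> occ u u" using Suc(2) by (cases u) auto
  then show ?case using occ_append_ge[of u u "concat (replicate t u)"] Suc by simp
qed simp

lemma mirror_concat_replicate: "mirror (concat (replicate t u)) = concat (replicate t (mirror u))"
proof (induction t)
  case (Suc t)
  have "concat (replicate t w) @ w = w @ concat (replicate t w)" for w :: "bool list"
    by (induction t) simp_all
  then show ?case using Suc by simp
qed simp

lemma occ_pos: "occ u p > 0 \<Longrightarrow> \<exists>x z. p = x @ u @ z"
proof (induction p)
  case (Cons a p)
  show ?case
  proof (cases "prefix u (a # p)")
    case True
    then obtain z where "a # p = [] @ u @ z" by (auto simp: prefix_def)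
    then show ?thesis by blast
  next
    case False
    then obtain x z where "p = x @ u @ z" using Cons by auto
    then have "a # p = (a # x) @ u @ z" by simp
    then show ?thesis by blast
  qed
qed simp

lemma nth_concat_replicate:
  "i < t * length w \<Longrightarrow> concat (replicate t w) ! i = w ! (i mod length w)"
proof (induction t arbitrary: i)
  case (Suc t)
  then show ?case by (cases "i < length w") (auto simp: nth_append le_mod_geq)
qed simp

text \<open>The letters of \<open>u\<close>, found at offset \<open>i\<close> in the periodic word, are those of \<open>w\<close> read from position
  \<open>i\<close> on modulo the length.\<close>

lemma occ_in_power_rotation:
  assumes "occ u (concat (replicate t w)) > 0" "length w = length u"
  shows "\<exists>x y. w = x @ y \<and> u = y @ x"
proof -
  obtain x z where xz: "concat (replicate t w) = x @ u @ z" using occ_pos[OF assms(1)] by blast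
  have len: "t * length w = length x + length u + length z"
    using arg_cong[OF xz, of length] by (simp add: length_concat sum_list_replicate)
  have "u = rotate (length x) w"
  proof (rule nth_equalityI)
    fix i assume i: "i < length u"
    have "u ! i = concat (replicate t w) ! (length x + i)" using i by (simp add: xz nth_append)
    also have "\<dots> = w ! ((length x + i) mod length w)"
      using i len by (intro nth_concat_replicate) simp
    also have "\<dots> = rotate (length x) w ! i" using i assms(2) by (simp add: nth_rotate)
    finally show "u ! i = rotate (length x) w ! i" .
  qed (simp add: assms)
  then show ?thesis by (metis append_take_drop_id rotate_drop_take)
qed

text \<open>In the power \<open>t\<close> the pattern occurs at least once per period. If it occurred in a power of its
  mirror image, it would be a rotation of it, and the matrix of \<open>u\<close> would be conjugate to its inverse.
  The sign \<open>E\<close> is harmless as it is its own inverse. Hence nothing is subtracted.\<close>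

lemma brooks_power:
  assumes "h \<in> SL2Z" "\<not> conjugate_SL2Z h (matrix_inv h)" "E \<in> centre" "u \<noteq> []"
    and conj: "conjugate_SL2Z h (E ** word_matrix u)"
  shows "brooks u (matrix_power h t) \<ge> int t - 6 * defect u"
proof -
  have "occ u (concat (replicate t (mirror u))) = 0"
  proof (rule ccontr)
    assume "\<not> ?thesis"
    then obtain x y where xy: "mirror u = x @ y" "u = y @ x"
      using occ_in_power_rotation[of u t "mirror u"] by auto
    \<comment> \<open>a rotation is a conjugation, and the mirror image is the inverse up to conjugation\<close>
    have "conjugate_SL2Z (word_matrix u) (word_matrix (mirror u))"
      unfolding xy(1) using conjugate_rotate[of y x] xy(2) by simp
    moreover have "conjugate_SL2Z (word_matrix (mirror u)) (adj (word_matrix u))"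
      unfolding adj_word_matrix conjugate_SL2Z_iff by (intro bexI[of _ quarter]) simp_all
    ultimately have "conjugate_SL2Z (E ** word_matrix u) (E ** adj (word_matrix u))"
      using conjugate_SL2Z_centre conjugate_SL2Z_trans assms(3) by metis
    moreover have "E ** adj (word_matrix u) = adj (E ** word_matrix u)"
      using assms(3) centre_commute by (simp add: adj_mult)
    ultimately have "conjugate_SL2Z h (adj h)"
      using conj conjugate_SL2Z_adj[OF conj] conjugate_SL2Z_trans conjugate_SL2Z_sym by metis
    then show False using assms(1,2) matrix_inv_SL2Z by simp
  qed
  then have bias: "bias u (concat (replicate t u)) \<ge> int t"
    using occ_concat_replicate[OF assms(4), of t] by (simp add: bias_def mirror_concat_replicate)
  obtain g where g: "g \<in> SL2Z" "h = g ** (E ** word_matrix u) ** adj g"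
    using conjugate_SL2Z_sym[OF conj] unfolding conjugate_SL2Z_iff by blast
  have SL: "matrix_power (E ** word_matrix u) t \<in> SL2Z" using assms(3) by simp
  show ?thesis
    using brooks_spells[OF SL spells_power[OF assms(3)], of u] brooks_conjugate[OF g(1) SL, of u] bias
    unfolding g(2) matrix_power_conjugate[OF g(1)] by linarith
qed

lemma alternations_replicate: "alternations (replicate n a) = 0"
proof (induction n)
  case (Suc n)
  then show ?case by (cases n) auto
qed simp

section \<open>Matrices of bounded trace\<close>

lemma no_alternation_bias:
  assumes "alternations p = 0"
  shows "bias (a # (\<not> a) # v) p = 0"
proof -
  obtain n b where p: "p = replicate n b" using no_alternation[OF assms] by blast
  have "mirror p = replicate n (\<not> b)" by (simp add: p mirror_def)
  then show ?thesis
    using occ_le_alternations[of a v p] occ_le_alternations[of a v "mirror p"]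
    by (simp add: bias_def p alternations_replicate)
qed

text \<open>A unipotent triangular matrix is a power of a single letter or the inverse of one, and no pattern
  containing a change of letters occurs there.\<close>

lemma brooks_unipotent:
  assumes "E \<in> centre"
  shows "\<bar>brooks (a # (\<not> a) # v) (E ** M22 1 b 0 1)\<bar> \<le> defect (a # (\<not> a) # v)"
    and "\<bar>brooks (a # (\<not> a) # v) (E ** M22 1 0 b 1)\<bar> \<le> defect (a # (\<not> a) # v)"
proof -
  have *: "\<bar>brooks (a # (\<not> a) # v) (E ** (if c then M22 1 b 0 1 else M22 1 0 b 1))\<bar>
      \<le> defect (a # (\<not> a) # v)" (is "\<bar>brooks ?u (E ** ?U)\<bar> \<le> _") for c
  proof -
    have U: "?U \<in> SL2Z" by simp
    let ?p = "replicate (nat \<bar>b\<bar>) c"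
    have bias: "bias ?u ?p = 0" by (rule no_alternation_bias[OF alternations_replicate])
    have "\<exists>p. spells p ?U \<and> bias ?u p = 0"
    proof (cases "b \<ge> 0")
      case True
      then have "?U = word_matrix ?p" by (simp add: word_matrix_replicate)
      then show ?thesis using spells_word_matrix bias by metis
    next
      case False
      then have "?U = adj (word_matrix ?p)" by (simp add: word_matrix_replicate)
      then have "spells (mirror ?p) ?U" using spells_adj[OF spells_word_matrix] by metis
      moreover have "bias ?u (mirror ?p) = 0" using bias by simp
      ultimately show ?thesis by blast
    qed
    then obtain p where p: "spells p ?U" "bias ?u p = 0" by blast
    have "spells p (E ** ?U)"
      using spells_turns[OF p(1), of E "mat 1"] assms by (simp del: if_split)
    moreover have "E ** ?U \<in> SL2Z" using assms U by (intro SL2Z_mult) simp_all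
    ultimately show ?thesis using brooks_spells[of "E ** ?U" p ?u] p(2) by simp
  qed
  show "\<bar>brooks (a # (\<not> a) # v) (E ** M22 1 b 0 1)\<bar> \<le> defect (a # (\<not> a) # v)" using *[of True] by simp
  show "\<bar>brooks (a # (\<not> a) # v) (E ** M22 1 0 b 1)\<bar> \<le> defect (a # (\<not> a) # v)" using *[of False] by simp
qed

lemma ex_centred_representative:
  fixes a c :: int assumes "c \<noteq> 0" shows "\<exists>k. 2 * \<bar>a + k * c\<bar> \<le> \<bar>c\<bar>"
proof -
  let ?m = "a mod \<bar>c\<bar>" and ?q = "a div \<bar>c\<bar>"
  have a: "a = ?q * \<bar>c\<bar> + ?m" by simp
  have m: "0 \<le> ?m" "?m < \<bar>c\<bar>" using assms by auto
  have s: "\<bar>c\<bar> = sgn c * c" by (simp add: abs_sgn mult.commute)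
  have "a + (- ?q * sgn c) * c = ?m" using a by (simp add: s mult.assoc)
  moreover have "a + (- ?q * sgn c - sgn c) * c = ?m - \<bar>c\<bar>" using a by (simp add: s algebra_simps)
  ultimately show ?thesis using m
    by (cases "2 * ?m \<le> \<bar>c\<bar>") (metis abs_of_nonneg, smt (verit))
qed

text \<open>The reduction theory of binary quadratic forms. In the conjugacy class choose a matrix whose lower
  left entry \<open>c\<close> has minimal absolute value. If \<open>c\<close> is nonzero, conjugation by a horizontal shear shifts \<open>a\<close> by multiples
  of \<open>c\<close>, and conjugation by a quarter turn exchanges \<open>b\<close> and \<open>c\<close> up to sign.\<close>

lemma reduced_conjugate:
  assumes "g \<in> SL2Z"
  obtains a b c d where "conjugate_SL2Z g (M22 a b c d)" "a * d - b * c = 1" "a + d = trace g"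
    "c = 0 \<or> 2 * \<bar>a\<bar> \<le> \<bar>c\<bar> \<and> \<bar>c\<bar> \<le> \<bar>b\<bar>"
proof -
  let ?P = "\<lambda>B. conjugate_SL2Z g B"
  obtain B where B: "?P B" "\<And>B'. ?P B' \<Longrightarrow> nat \<bar>B $ 2 $ 1\<bar> \<le> nat \<bar>B' $ 2 $ 1\<bar>"
    using ex_has_least_nat[of ?P g "\<lambda>B. nat \<bar>B $ 2 $ 1\<bar>"] conjugate_SL2Z_refl by blast
  have facts: "a * d - b * c = 1 \<and> a + d = trace g" if P: "?P (M22 a b c d)" for a b c d
  proof -
    obtain k where "k \<in> SL2Z" "M22 a b c d = k ** g ** adj k"
      using P unfolding conjugate_SL2Z_iff by blast
    then have "M22 a b c d \<in> SL2Z" using assms by simp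
    then show ?thesis using conjugate_SL2Z_trace[OF P] by simp
  qed
  obtain a b c d where M: "B = M22 a b c d" by (cases B)
  show thesis
  proof (cases "c = 0")
    case True
    then show thesis using that[of a b c d] B(1) facts[of a b c d] M by simp
  next
    case False
    then obtain k where k: "2 * \<bar>a + k * c\<bar> \<le> \<bar>c\<bar>" using ex_centred_representative by blast
    let ?a = "a + k * c" and ?b = "b + k * d - k * (a + k * c)" and ?d = "d - k * c"
    have "M22 1 k 0 1 ** M22 a b c d ** adj (M22 1 k 0 1) = M22 ?a ?b c ?d"
      by (simp add: algebra_simps)
    then have "conjugate_SL2Z (M22 a b c d) (M22 ?a ?b c ?d)"
      unfolding conjugate_SL2Z_iff by (intro bexI[of _ "M22 1 k 0 1"]) simp_all
    then have P: "?P (M22 ?a ?b c ?d)" using conjugate_SL2Z_trans B(1) M by blast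
    have "quarter ** M22 ?a ?b c ?d ** adj quarter = M22 ?d (- c) (- ?b) ?a"
      by (simp add: quarter_def)
    then have "conjugate_SL2Z (M22 ?a ?b c ?d) (M22 ?d (- c) (- ?b) ?a)"
      unfolding conjugate_SL2Z_iff by (intro bexI[of _ quarter]) simp_all
    then have "?P (M22 ?d (- c) (- ?b) ?a)" using conjugate_SL2Z_trans P by blast
    from B(2)[OF this] have "\<bar>c\<bar> \<le> \<bar>?b\<bar>" by (simp add: M)
    then show thesis using that[OF P] facts[OF P] k by blast
  qed
qed

text \<open>From \<open>b * c = a * d - 1\<close> and \<open>d = trace - a\<close>, the square of \<open>c\<close> is bounded by one quarter of
  itself plus a term linear in \<open>c\<close>.\<close>

lemma reduced_entry_bounds:
  fixes a b c d T :: int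
  assumes det: "a * d - b * c = 1" and tr: "\<bar>a + d\<bar> \<le> T"
    and c: "c \<noteq> 0" "2 * \<bar>a\<bar> \<le> \<bar>c\<bar>" "\<bar>c\<bar> \<le> \<bar>b\<bar>"
  shows "\<bar>a\<bar> \<le> T + 2" "\<bar>c\<bar> \<le> T + 2" "\<bar>d\<bar> \<le> 2 * T + 2" "\<bar>b\<bar> \<le> (T + 2) * (2 * T + 2) + 1"
proof -
  have d: "\<bar>d\<bar> \<le> T + \<bar>a\<bar>" using tr by linarith
  have bc: "\<bar>b * c\<bar> \<le> \<bar>a * d\<bar> + 1" using det by linarith
  have "\<bar>c\<bar> * \<bar>c\<bar> \<le> \<bar>b\<bar> * \<bar>c\<bar>" using c by (intro mult_right_mono) auto
  also have "\<dots> \<le> \<bar>a\<bar> * \<bar>d\<bar> + 1" using bc by (simp add: abs_mult)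
  finally have 1: "\<bar>c\<bar> * \<bar>c\<bar> \<le> \<bar>a\<bar> * \<bar>d\<bar> + 1" .
  have "(2 * \<bar>a\<bar>) * (2 * \<bar>d\<bar>) \<le> \<bar>c\<bar> * (2 * T + \<bar>c\<bar>)"
    using c d by (intro mult_mono) auto
  then have 2: "4 * (\<bar>c\<bar> * \<bar>c\<bar>) \<le> \<bar>c\<bar> * (2 * T + \<bar>c\<bar>) + 4" using 1 by linarith
  show C: "\<bar>c\<bar> \<le> T + 2"
  proof (rule ccontr)
    assume *: "\<not> ?thesis"
    have "\<bar>c\<bar> * (2 * T + \<bar>c\<bar>) \<le> \<bar>c\<bar> * (3 * \<bar>c\<bar> - 6)" using * by (intro mult_left_mono) auto
    then have "\<bar>c\<bar> * \<bar>c\<bar> + 6 * \<bar>c\<bar> \<le> 4" using 2 by (simp add: algebra_simps)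
    moreover have "\<bar>c\<bar> \<ge> 1" "\<bar>c\<bar> * \<bar>c\<bar> \<ge> 0" using c by auto
    ultimately show False by linarith
  qed
  show A: "\<bar>a\<bar> \<le> T + 2" using c C by linarith
  show D: "\<bar>d\<bar> \<le> 2 * T + 2" using c C d tr by linarith
  have "\<bar>b\<bar> * 1 \<le> \<bar>b\<bar> * \<bar>c\<bar>" using c by (intro mult_left_mono) auto
  also have "\<dots> \<le> \<bar>a\<bar> * \<bar>d\<bar> + 1" using bc by (simp add: abs_mult)
  also have "\<bar>a\<bar> * \<bar>d\<bar> \<le> (T + 2) * (2 * T + 2)" using A D by (intro mult_mono) auto
  finally show "\<bar>b\<bar> \<le> (T + 2) * (2 * T + 2) + 1" by simp
qed

text \<open>The reduced conjugate is plus or minus unipotent if \<open>c = 0\<close>, and otherwise lies in a finite box that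
  only depends on \<open>T\<close>. Conjugation by a matrix of any size costs a multiple of the defect.\<close>

lemma brooks_bounded_trace:
  fixes T :: int
  shows "\<exists>B. \<forall>g\<in>SL2Z. \<bar>trace g\<bar> \<le> T \<longrightarrow> \<bar>brooks (\<epsilon> # (\<not> \<epsilon>) # v) g\<bar> \<le> B"
proof -
  let ?u = "\<epsilon> # (\<not> \<epsilon>) # v"
  \<comment> \<open>a common bound for the four entries in \<open>reduced_entry_bounds\<close>\<close>
  define K where "K = (T + 2) * (2 * T + 2) + 2 * T + 3"
  define box where "box = (\<lambda>(a, b, c, d). M22 a b c d) ` ({-K..K} \<times> {-K..K} \<times> {-K..K} \<times> {-K..K})"
  define B where "B = Max (insert 0 ((\<lambda>A. \<bar>brooks ?u A\<bar>) ` box))"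
  have fin: "finite (insert 0 ((\<lambda>A. \<bar>brooks ?u A\<bar>) ` box))" by (simp add: box_def)
  have B: "\<bar>brooks ?u A\<bar> \<le> B" if "A \<in> box" for A
    unfolding B_def using fin that by (intro Max_ge) auto
  have B0: "B \<ge> 0" unfolding B_def using fin by (intro Max_ge) auto
  have "\<bar>brooks ?u g\<bar> \<le> B + 6 * defect ?u" if g: "g \<in> SL2Z" "\<bar>trace g\<bar> \<le> T" for g
  proof -
    obtain a b c d where M: "conjugate_SL2Z g (M22 a b c d)" "a * d - b * c = 1" "a + d = trace g"
      "c = 0 \<or> 2 * \<bar>a\<bar> \<le> \<bar>c\<bar> \<and> \<bar>c\<bar> \<le> \<bar>b\<bar>"
      using reduced_conjugate[OF g(1)] .
    have T: "T \<ge> 0" using g by linarith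
    have "\<bar>brooks ?u (M22 a b c d)\<bar> \<le> B + defect ?u"
    proof (cases "c = 0")
      case True
      then have "a * d = 1" using M(2) by simp
      then consider "a = 1" "d = 1" | "a = -1" "d = -1" by (auto simp: zmult_eq_1_iff)
      then show ?thesis
      proof cases
        case 1
        then have eq: "M22 a b c d = M22 1 0 0 1 ** M22 1 b 0 1" using True by simp
        show ?thesis
          unfolding eq using brooks_unipotent(1)[of "M22 1 0 0 1" \<epsilon> v b] B0 by (simp add: centre_def)
      next
        case 2
        then have eq: "M22 a b c d = M22 (-1) 0 0 (-1) ** M22 1 (-b) 0 1" using True by simp
        show ?thesis
          unfolding eq using brooks_unipotent(1)[of "M22 (-1) 0 0 (-1)" \<epsilon> v "-b"] B0
          by (simp add: centre_def)
      qed
    next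
      case False
      have "a \<in> {-K..K}" "b \<in> {-K..K}" "c \<in> {-K..K}" "d \<in> {-K..K}"
      proof -
        have ac: "2 * \<bar>a\<bar> \<le> \<bar>c\<bar>" "\<bar>c\<bar> \<le> \<bar>b\<bar>" using M(4) False by auto
        have tr: "\<bar>a + d\<bar> \<le> T" using M(3) g(2) by simp
        have "0 \<le> (T + 2) * (2 * T + 2)" using T by simp
        then show "a \<in> {-K..K}" "b \<in> {-K..K}" "c \<in> {-K..K}" "d \<in> {-K..K}"
          using reduced_entry_bounds[OF M(2) tr False ac] T unfolding K_def atLeastAtMost_iff
          by linarith+
      qed
      then have "M22 a b c d \<in> box" unfolding box_def by force
      then show ?thesis using B defect_nonneg[of ?u] by (meson add_increasing2 order_trans)
    qed
    moreover obtain k where "k \<in> SL2Z" "g = k ** M22 a b c d ** adj k"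
      using conjugate_SL2Z_sym[OF M(1)] unfolding conjugate_SL2Z_iff by blast
    ultimately show ?thesis using brooks_conjugate[of k "M22 a b c d" ?u] M(2) by simp
  qed
  then show ?thesis by blast
qed

section \<open>Resonances of the kicked product\<close>

text \<open>Bezout coefficients with \<open>x\<close> reduced modulo \<open>k1\<close>; the quadratic bound is enough because only its
  logarithm will be used.\<close>

lemma primitive_row_extends:
  fixes k1 k2 N :: int
  assumes "coprime k1 k2" "\<bar>k1\<bar> \<le> N" "\<bar>k2\<bar> \<le> N" "N \<ge> 1"
  obtains x y where "M22 k1 k2 x y \<in> SL2Z" "entry_sum (M22 k1 k2 x y) \<le> 6 * N\<^sup>2"
proof (cases "k1 = 0")
  case True
  then have k2: "\<bar>k2\<bar> = 1" using assms(1) by simp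
  then have "k2 * k2 = 1" by (metis abs_mult_self_eq mult_1)
  then have "M22 k1 k2 (- k2) 0 \<in> SL2Z" by (simp add: True)
  moreover have "1 \<le> N\<^sup>2" using assms(4) by (simp add: one_le_power)
  then have "entry_sum (M22 k1 k2 (- k2) 0) \<le> 6 * N\<^sup>2" using k2 by (simp add: True entry_sum_def)
  ultimately show thesis using that by blast
next
  case False
  obtain s t where st: "s * k1 + t * k2 = 1"
    using assms(1) bezout_int[of k1 k2] by (auto simp: coprime_iff_gcd_eq_1)
  \<comment> \<open>The solutions of \<open>k1 * y - k2 * x = 1\<close> have \<open>x\<close> in the class of \<open>- t\<close> modulo \<open>k1\<close>; take the smallest.\<close>
  define x where "x = (- t) mod \<bar>k1\<bar>"
  have x: "0 \<le> x" "x < \<bar>k1\<bar>" using False by (simp_all add: x_def)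
  have "k1 dvd x + t"
  proof -
    have "\<bar>k1\<bar> dvd - t - x" by (simp add: x_def minus_mod_eq_mult_div)
    then have "k1 dvd - t - x" by simp
    then have "k1 dvd - (- t - x)" by (simp only: dvd_minus_iff)
    then show ?thesis by (simp add: add.commute)
  qed
  then obtain m where m: "x + t = k1 * m" by (auto simp: dvd_def)
  define y where "y = s + m * k2"
  have det: "k1 * y - k2 * x = 1"
  proof -
    have "k1 * y - k2 * x = k1 * s + (k1 * m) * k2 - k2 * x" by (simp add: y_def algebra_simps)
    also have "\<dots> = 1" using st by (simp add: algebra_simps flip: m)
    finally show ?thesis .
  qed
  have N: "N \<le> N\<^sup>2" using assms(4) by (simp add: power2_eq_square)
  have "\<bar>k2 * x\<bar> \<le> N * N" unfolding abs_mult using assms x by (intro mult_mono) auto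
  then have "\<bar>k1 * y\<bar> \<le> 1 + N\<^sup>2" using det by (simp add: power2_eq_square)
  moreover have "1 * \<bar>y\<bar> \<le> \<bar>k1\<bar> * \<bar>y\<bar>" using False by (intro mult_right_mono) auto
  ultimately have "\<bar>y\<bar> \<le> 1 + N\<^sup>2" by (simp add: abs_mult)
  then have "entry_sum (M22 k1 k2 x y) \<le> 6 * N\<^sup>2" using assms x N by (simp add: entry_sum_def)
  then show thesis using that[of x y] det by simp
qed

text \<open>Dividing by the greatest common divisor makes both rows primitive, so they are first rows of
  matrices \<open>P\<close> and \<open>Q\<close> in \<open>SL(2,Z)\<close> with entries quadratic in \<open>N\<close>. The product of \<open>P\<close>, \<open>A\<close> and the inverse
  of \<open>Q\<close> fixes the first unit row, so it is unipotent and contributes a bounded amount, while \<open>P\<close> and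
  \<open>Q\<close> contribute logarithmically in \<open>N\<close>.\<close>

lemma row_resonance_bound:
  fixes k1 k2 N :: int
  assumes A: "A \<in> SL2Z" and k: "(k1, k2) \<noteq> (0, 0)" "\<bar>k1\<bar> \<le> N" "\<bar>k2\<bar> \<le> N"
    and l: "\<bar>k1 * A $ 1 $ 1 + k2 * A $ 2 $ 1\<bar> \<le> N" "\<bar>k1 * A $ 1 $ 2 + k2 * A $ 2 $ 2\<bar> \<le> N"
  shows "(3/2) powr \<bar>real_of_int (brooks (a # (\<not> a) # v) A)\<bar>
    \<le> 9 * (3/2) powr (6 * real_of_int (defect (a # (\<not> a) # v))) * real_of_int N ^ 4"
proof -
  let ?u = "a # (\<not> a) # v"
  obtain p q r s where M: "A = M22 p q r s" by (cases A)
  have det: "p * s - q * r = 1" using A M by simp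
  define e where "e = gcd k1 k2"
  have e: "e \<noteq> 0" "e > 0" using k(1) by (auto simp: e_def)
  obtain c1 c2 where c: "k1 = c1 * e" "k2 = c2 * e" "coprime c1 c2"
    using gcd_coprime_exists[of k1 k2] e unfolding e_def by blast
  define l1 l2 where "l1 = c1 * p + c2 * r" and "l2 = c1 * q + c2 * s"
  have le: "\<bar>x\<bar> \<le> N" if "\<bar>x * e\<bar> \<le> N" for x
  proof -
    have "\<bar>x\<bar> * 1 \<le> \<bar>x\<bar> * e" using e by (intro mult_left_mono) auto
    then show ?thesis using that e by (simp add: abs_mult)
  qed
  have cN: "\<bar>c1\<bar> \<le> N" "\<bar>c2\<bar> \<le> N" using k c le by blast+
  have "k1 * A $ 1 $ 1 + k2 * A $ 2 $ 1 = l1 * e" "k1 * A $ 1 $ 2 + k2 * A $ 2 $ 2 = l2 * e"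
    by (simp_all add: l1_def l2_def c M algebra_simps)
  then have lN: "\<bar>l1\<bar> \<le> N" "\<bar>l2\<bar> \<le> N" using l le by metis+
  have "c1 \<noteq> 0 \<or> c2 \<noteq> 0" using c(3) by auto
  then have N: "N \<ge> 1" using cN by linarith
  have inv: "c1 = l1 * s - l2 * r" "c2 = l2 * p - l1 * q"
    unfolding l1_def l2_def using det by algebra+
  have "coprime l1 l2"
  proof (rule coprimeI)
    fix d assume "d dvd l1" "d dvd l2"
    then have "d dvd c1" "d dvd c2" unfolding inv by simp_all
    then show "is_unit d" using c(3) coprime_common_divisor by blast
  qed
  obtain x y where g1: "M22 c1 c2 x y \<in> SL2Z" "entry_sum (M22 c1 c2 x y) \<le> 6 * N\<^sup>2"
    using primitive_row_extends[OF c(3) cN N] .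
  obtain z w where g2: "M22 l1 l2 z w \<in> SL2Z" "entry_sum (M22 l1 l2 z w) \<le> 6 * N\<^sup>2"
    using primitive_row_extends[OF \<open>coprime l1 l2\<close> lN N] .
  \<comment> \<open>\<open>U\<close> maps the first unit row to \<open>(c1, c2)\<close>, then to \<open>(l1, l2)\<close>, then back to the first unit row\<close>
  define U where "U = M22 c1 c2 x y ** A ** adj (M22 l1 l2 z w)"
  have "\<exists>m. U = M22 1 0 m 1"
  proof -
    obtain u1 u2 u3 u4 where U4: "U = M22 u1 u2 u3 u4" by (cases U)
    have "u1 = l1 * w - l2 * z" "u2 = 0"
      using U4 unfolding U_def M by (auto simp: l1_def l2_def algebra_simps)
    moreover have "l1 * w - l2 * z = 1" using g2(1) by simp
    moreover have "U \<in> SL2Z" unfolding U_def by (intro SL2Z_mult A g1(1) adj_SL2Z[THEN iffD2] g2(1))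
    ultimately show ?thesis using U4 by auto
  qed
  then obtain m where m: "U = M22 1 0 m 1" by blast
  have bU: "\<bar>brooks ?u U\<bar> \<le> defect ?u"
    using brooks_unipotent(2)[OF one_centre, of a v m] by (simp add: m)
  have A_eq: "A = adj (M22 c1 c2 x y) ** (U ** M22 l1 l2 z w)"
  proof -
    have "A = adj P ** (P ** A ** adj Q ** Q)" if "P \<in> SL2Z" "Q \<in> SL2Z" for P Q
      using that by (simp flip: matrix_mul_assoc)
    then show ?thesis unfolding U_def using g1(1) g2(1) .
  qed
  have "\<bar>brooks ?u A\<bar> \<le> \<bar>brooks ?u (M22 c1 c2 x y)\<bar> + \<bar>brooks ?u (M22 l1 l2 z w)\<bar> + 6 * defect ?u"
  proof -
    have "\<bar>brooks ?u (adj P ** (U ** Q))\<bar> \<le> \<bar>brooks ?u P\<bar> + \<bar>brooks ?u Q\<bar> + 6 * defect ?u"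
      if "P \<in> SL2Z" "Q \<in> SL2Z" "U \<in> SL2Z" for P Q
      using brooks_mult[of "adj P" "U ** Q" ?u] brooks_mult[of U Q ?u] brooks_adj[of P ?u] bU that
      by simp
    moreover have "U \<in> SL2Z" using m by simp
    ultimately show ?thesis using A_eq g1(1) g2(1) by metis
  qed
  then have "real_of_int \<bar>brooks ?u A\<bar> \<le> real_of_int (\<bar>brooks ?u (M22 c1 c2 x y)\<bar> + \<bar>brooks ?u (M22 l1 l2 z w)\<bar> + 6 * defect ?u)"
    by (simp only: of_int_le_iff)
  then have "(3/2) powr \<bar>real_of_int (brooks ?u A)\<bar>
     \<le> (3/2) powr (6 * real_of_int (defect ?u)) *
       ((3/2) powr \<bar>real_of_int (brooks ?u (M22 c1 c2 x y))\<bar> *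
        (3/2) powr \<bar>real_of_int (brooks ?u (M22 l1 l2 z w))\<bar>)"
    by (simp flip: powr_add)
  also have "\<dots> \<le> (3/2) powr (6 * real_of_int (defect ?u)) * ((3 * real_of_int N ^ 2) * (3 * real_of_int N ^ 2))"
  proof -
    have "(3/2) powr \<bar>real_of_int (brooks ?u g)\<bar> \<le> 3 * real_of_int N ^ 2"
      if "g \<in> SL2Z" "entry_sum g \<le> 6 * N\<^sup>2" for g
    proof -
      have "real_of_int (entry_sum g) \<le> 6 * real_of_int N ^ 2"
        using that(2) by (metis of_int_le_iff of_int_mult of_int_numeral of_int_power)
      then show ?thesis using brooks_growth[OF that(1), of a v] by linarith
    qed
    then show ?thesis using g1 g2 by (intro mult_left_mono mult_mono) auto
  qed
  finally show ?thesis by (simp add: algebra_simps power_numeral_reduce)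
qed

lemma kicked_product_SL2Z:
  assumes "h \<in> SL2Z" "\<And>i. i \<ge> 1 \<Longrightarrow> \<phi> i \<in> SL2Z"
  shows "kicked_product h \<phi> t n \<in> SL2Z"
  using assms by (induction n) simp_all

lemma brooks_one: "\<bar>brooks u (mat 1)\<bar> \<le> defect u"
  using brooks_spells[OF SL2Z_one, of "[]" u] spells_word_matrix[of "[]"] by simp

definition row_act :: "int \<times> int \<Rightarrow> int ^ 2 ^ 2 \<Rightarrow> int \<times> int" where
  "row_act k A = (fst k * A $ 1 $ 1 + snd k * A $ 2 $ 1, fst k * A $ 1 $ 2 + snd k * A $ 2 $ 2)"

definition frequency_le :: "nat \<Rightarrow> int \<times> int \<Rightarrow> bool" where
  "frequency_le N k \<longleftrightarrow> \<bar>fst k\<bar> \<le> int N \<and> \<bar>snd k\<bar> \<le> int N"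

definition resonance_free :: "nat \<Rightarrow> int ^ 2 ^ 2 \<Rightarrow> bool" where
  "resonance_free N A \<longleftrightarrow> (\<forall>k. k \<noteq> 0 \<longrightarrow> frequency_le N k \<longrightarrow> \<not> frequency_le N (row_act k A))"

text \<open>Each step multiplies by a kick, of value at least \<open>- B\<close>, and by a power of \<open>h\<close>, of value at least
  \<open>t - 6 * defect u\<close>; the two multiplications lose at most \<open>4 * defect u\<close>. So beyond
  \<open>t0 = B + 10 * defect u\<close> the quasimorphism grows at least linearly in the number of steps, against
  the logarithmic bound that a resonance would impose.\<close>

lemma kicked_product_resonance_free:
  fixes h :: "int ^ 2 ^ 2" and \<phi> :: "nat \<Rightarrow> int ^ 2 ^ 2"
  assumes h: "h \<in> SL2Z" "hyperbolic h" "\<not> conjugate_SL2Z h (matrix_inv h)"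
    and \<phi>: "\<And>i. i \<ge> 1 \<Longrightarrow> \<phi> i \<in> SL2Z" "bounded ((\<lambda>i. trace (\<phi> i)) ` {1..})"
  shows "\<exists>t0::nat. \<exists>\<rho>>1. \<exists>K>0. \<forall>t>t0. \<forall>n N.
    K * real N ^ 4 < \<rho> ^ n \<longrightarrow> resonance_free N (kicked_product h \<phi> t n)"
proof -
  obtain E a v where E: "E \<in> centre" and conj: "conjugate_SL2Z h (E ** word_matrix (a # (\<not> a) # v))"
    using hyperbolic_conjugate_alternating_word[OF h(1,2)] .
  define u where "u = a # (\<not> a) # v"
  obtain T where bd: "\<forall>x\<in>(\<lambda>i. trace (\<phi> i)) ` {1..}. norm x \<le> T" using \<phi>(2) unfolding bounded_iff by blast
  then have T: "\<bar>trace (\<phi> i)\<bar> \<le> \<lceil>T\<rceil>" if "i \<ge> 1" for i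
  proof -
    have "\<bar>real_of_int (trace (\<phi> i))\<bar> \<le> T" using that bd by auto
    then have "real_of_int \<bar>trace (\<phi> i)\<bar> \<le> real_of_int \<lceil>T\<rceil>" by linarith
    then show ?thesis by (simp only: of_int_le_iff)
  qed
  obtain B where "\<forall>g\<in>SL2Z. \<bar>trace g\<bar> \<le> \<lceil>T\<rceil> \<longrightarrow> \<bar>brooks u g\<bar> \<le> B"
    using brooks_bounded_trace unfolding u_def by blast
  then have B: "\<bar>brooks u (\<phi> i)\<bar> \<le> B" if "i \<ge> 1" for i using that T \<phi>(1) by blast
  define t0 where "t0 = nat (10 * defect u + B)"
  have SL: "kicked_product h \<phi> t n \<in> SL2Z" for t n using kicked_product_SL2Z h(1) \<phi>(1) by blast
  have growth: "brooks u (kicked_product h \<phi> t n) \<ge> int n - defect u" if t: "t > t0" for t n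
  proof (induction n)
    case 0
    show ?case using brooks_one[of u] by simp
  next
    case (Suc n)
    have "brooks u (matrix_power h t) \<ge> int t - 6 * defect u"
      by (rule brooks_power[OF h(1,3) E _ conj[folded u_def]]) (simp add: u_def)
    moreover have "int t \<ge> 10 * defect u + B + 1" using t unfolding t0_def by linarith
    ultimately show ?case
      using Suc B[of "Suc n"] brooks_mult[of "\<phi> (Suc n) ** matrix_power h t" "kicked_product h \<phi> t n" u]
        brooks_mult[of "\<phi> (Suc n)" "matrix_power h t" u] h(1) \<phi>(1)[of "Suc n"] SL
      by simp
  qed
  define D where "D = real_of_int (defect u)"
  define K where "K = 9 * (3/2) powr (6 * D) * (3/2) powr D"
  have bound: "(3/2) ^ n \<le> K * real N ^ 4"
    if t: "t > t0" and k: "k \<noteq> 0" "frequency_le N k" "frequency_le N (row_act k (kicked_product h \<phi> t n))" for t n N k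
  proof -
    have k0: "(fst k, snd k) \<noteq> (0, 0)" using k(1) by (simp add: zero_prod_def)
    have "real n \<le> \<bar>real_of_int (brooks u (kicked_product h \<phi> t n))\<bar> + D"
      using growth[OF t, of n] unfolding D_def by linarith
    then have "(3/2) ^ n \<le> (3/2) powr \<bar>real_of_int (brooks u (kicked_product h \<phi> t n))\<bar> * (3/2) powr D"
      by (simp flip: powr_add powr_realpow)
    also have "\<dots> \<le> (9 * (3/2) powr (6 * D) * real_of_int (int N) ^ 4) * (3/2) powr D"
      using k(2,3) unfolding D_def u_def frequency_le_def row_act_def fst_conv snd_conv
      by (intro mult_right_mono row_resonance_bound[OF SL k0]) simp_all
    finally show ?thesis by (simp add: K_def algebra_simps)
  qed
  have "K > 0" by (simp add: K_def)
  moreover have "\<forall>t>t0. \<forall>n N. K * real N ^ 4 < (3/2) ^ n \<longrightarrow> resonance_free N (kicked_product h \<phi> t n)"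
    unfolding resonance_free_def using bound by (meson linorder_not_le)
  moreover have "(3/2 :: real) > 1" by simp
  ultimately show ?thesis by blast
qed

section \<open>Integration and characters on the torus\<close>

text \<open>Functions on the torus are integrated as periodic functions over the unit square.\<close>

definition square :: "(real ^ 2) measure" where
  "square = restrict_space lborel unit_square"

lemma emeasure_square: "emeasure square (space square) = 1"
proof -
  have sp: "space torus_measure = UNIV" by (simp add: torus_measure_def)
  have "emeasure torus_measure UNIV = emeasure square (torus_proj -` UNIV \<inter> space square)"
    unfolding torus_measure_def square_def by (rule emeasure_distr[OF torus_proj_measurable]) simp
  then show ?thesis using emeasure_torus_measure by (simp add: sp)
qed

interpretation square: finite_measure square
  by standard (simp add: emeasure_square)

lemma measure_square [simp]: "measure square (space square) = 1"
  by (simp add: measure_def emeasure_square)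

lemma integrable_square:
  fixes g :: "real ^ 2 \<Rightarrow> 'b::{banach, second_countable_topology}"
  assumes "continuous_on UNIV g"
  shows "integrable square g"
proof -
  have comp: "compact (g ` cbox 0 1)"
    by (rule compact_continuous_image[OF continuous_on_subset[OF assms] compact_cbox]) simp
  then obtain B where B: "\<And>u. u \<in> cbox 0 1 \<Longrightarrow> norm (g u) \<le> B"
    using compact_imp_bounded[OF comp] unfolding bounded_iff by auto
  have "norm (g u) \<le> B" if "u \<in> space square" for u
    using that by (intro B) (simp add: square_def space_restrict_space unit_square_def mem_box_cart less_imp_le)
  then have "AE u in square. norm (g u) \<le> B" by (rule AE_I2)
  moreover have "g \<in> borel_measurable square"
    unfolding square_def
    by (intro measurable_restrict_space1) (simp add: borel_measurable_continuous_onI assms)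
  ultimately show ?thesis by (rule square.integrable_const_bound)
qed

lemma integral_torus:
  fixes F :: "torus \<Rightarrow> complex"
  assumes "continuous_on UNIV F"
  shows "(LINT x|torus_measure. F x) = (LINT u|square. F (torus_proj u))"
  unfolding torus_measure_def square_def
  by (rule integral_distr[OF torus_proj_measurable]) (rule borel_measurable_continuous_onI[OF assms])

lemma dist_torus_lift:
  assumes "dist (torus_proj u) y < d"
  obtains v where "y = torus_proj v" "dist u v < d"
proof -
  have "infdist u (torus_fiber y) < d"
    using assms by (simp add: dist_torus_def setdist_torus_fiber)
  then obtain v where "v \<in> torus_fiber y" "dist u v < d"
    unfolding infdist_notempty[OF torus_fiber_nonempty]
    using cInf_lessD[of "(\<lambda>v. dist u v) ` torus_fiber y" d] torus_fiber_nonempty by auto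
  then show thesis using that by (auto simp: torus_fiber_def)
qed

text \<open>Nearby points of the torus have nearby representatives, on which the action is linear.\<close>

lemma continuous_torus_act: "continuous_on UNIV (torus_act A)"
  unfolding continuous_on_iff
proof (intro ballI allI impI)
  fix x :: torus and e :: real assume e: "e > 0"
  obtain u where u: "x = torus_proj u" using torus_proj_surj by blast
  have "continuous_on UNIV (\<lambda>u. map_matrix real_of_int A *v u)"
    by (intro linear_continuous_on matrix_vector_mul_bounded_linear)
  then obtain d where d: "d > 0"
    "\<And>v. dist v u < d \<Longrightarrow> dist (map_matrix real_of_int A *v v) (map_matrix real_of_int A *v u) < e"
    unfolding continuous_on_iff using e by (metis UNIV_I)
  have "dist (torus_act A y) (torus_act A x) < e" if y: "dist y x < d" for y
  proof -
    obtain v where v: "y = torus_proj v" "dist u v < d"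
      using y dist_torus_lift unfolding u by (metis dist_commute)
    have "dist (torus_act A y) (torus_act A x)
        \<le> dist (map_matrix real_of_int A *v v) (map_matrix real_of_int A *v u)"
      unfolding u v(1) torus_act_proj by (rule dist_torus_proj_le)
    then show ?thesis using d(2)[of v] v(2) by (simp add: dist_commute)
  qed
  then show "\<exists>d>0. \<forall>y\<in>UNIV. dist y x < d \<longrightarrow> dist (torus_act A y) (torus_act A x) < e"
    using d(1) by blast
qed

lemma hoelder_continuous:
  assumes "hoelder F" shows "continuous_on UNIV F"
proof -
  obtain g c where gc: "g > 0" "c > 0" "\<And>x y. norm (F x - F y) \<le> c * dist x y powr g"
    using assms unfolding hoelder_def by blast
  show ?thesis
    unfolding continuous_on_iff
  proof (intro ballI allI impI)
    fix x :: torus and e :: real assume e: "e > 0"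
    define d where "d = (e / c) powr (1 / g)"
    have "dist (F y) (F x) < e" if "dist y x < d" for y
    proof -
      have "dist y x powr g < d powr g" using that gc by (intro powr_less_mono2) auto
      also have "d powr g = e / c" using gc e by (simp add: d_def powr_powr)
      finally have "c * dist y x powr g < e" using gc by (simp add: field_simps)
      then show ?thesis using gc(3)[of y x] by (simp add: dist_norm)
    qed
    moreover have "d > 0" using e gc by (simp add: d_def)
    ultimately show "\<exists>d>0. \<forall>y\<in>UNIV. dist y x < d \<longrightarrow> dist (F y) (F x) < e" by blast
  qed
qed

lemma correlation_square:
  assumes "continuous_on UNIV F1" "continuous_on UNIV F2"
  shows "correlation F1 F2 A =
    (LINT u|square. F1 (torus_proj (map_matrix real_of_int A *v u)) * F2 (torus_proj u))
    - (LINT u|square. F1 (torus_proj u)) * (LINT u|square. F2 (torus_proj u))"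
proof -
  have "continuous_on UNIV (\<lambda>x. F1 (torus_act A x) * F2 x)"
    by (intro continuous_intros assms continuous_on_compose2[OF assms(1) continuous_torus_act]) auto
  then show ?thesis unfolding correlation_def by (simp add: integral_torus assms torus_act_proj)
qed

definition wave :: "int \<times> int \<Rightarrow> real ^ 2 \<Rightarrow> complex" where
  "wave k u = cis (2 * pi * (of_int (fst k) * u $ 1 + of_int (snd k) * u $ 2))"

lemma wave_zero [simp]: "wave 0 u = 1"
  by (simp add: wave_def)

lemma wave_add: "wave (k + l) u = wave k u * wave l u"
  by (simp add: wave_def cis_mult algebra_simps)

lemma wave_uminus: "wave (- k) u = cnj (wave k u)"
  by (simp add: wave_def cis_cnj) (simp add: algebra_simps)

lemma wave_diff_arg: "wave k (u - v) = wave k u * wave (- k) v"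
  by (simp add: wave_def cis_mult algebra_simps)

lemma continuous_wave [continuous_intros]:
  "continuous_on S g \<Longrightarrow> continuous_on S (\<lambda>u. wave k (g u))"
  unfolding wave_def by (intro continuous_intros)

text \<open>A full number of periods of the complex exponential, by the fundamental theorem of calculus.\<close>

lemma integral_cis_unit_interval:
  fixes m :: int assumes "m \<noteq> 0"
  shows "(LINT t|lborel. indicator {0..<1} t *\<^sub>R cis (2 * pi * (of_int m * t))) = 0"
proof -
  let ?a = "2 * pi * of_int m"
  let ?F = "\<lambda>t. - \<i> * cis (?a * t) / of_real ?a"
  have "(LINT t|lborel. indicator {0..<1} t *\<^sub>R cis (2 * pi * (of_int m * t)))
      = (LINT t|lborel. indicator {0..1} t *\<^sub>R cis (?a * t))"
  proof (rule integral_cong_AE)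
    show "AE t in lborel. indicator {0..<1} t *\<^sub>R cis (2 * pi * (of_int m * t))
        = indicator {0..1} t *\<^sub>R cis (?a * t)"
      using AE_lborel_singleton[of "1::real"] by eventually_elim (auto simp: indicator_def mult.assoc)
    have [measurable]: "(\<lambda>t. cis (c * t)) \<in> borel_measurable borel" for c
      by (intro borel_measurable_continuous_onI continuous_intros)
    show "(\<lambda>t. indicator {0..1::real} t *\<^sub>R cis (?a * t)) \<in> borel_measurable lborel"
      by measurable
    show "(\<lambda>t. indicator {0..<1::real} t *\<^sub>R cis (2 * pi * (of_int m * t))) \<in> borel_measurable lborel"
      unfolding mult.assoc[symmetric] by measurable
  qed
  also have "\<dots> = ?F 1 - ?F 0"
  proof (rule integral_FTC_Icc)
    fix t :: real assume "0 \<le> t" "t \<le> 1"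
    have "((\<lambda>t. cis (?a * t)) has_vector_derivative of_real ?a * (\<i> * cis (?a * t))) (at t within {0..1})"
    proof -
      have "((\<lambda>z. exp (\<i> * (of_real ?a * z))) has_field_derivative
          of_real ?a * (\<i> * exp (\<i> * (of_real ?a * of_real t)))) (at (of_real t))"
        by (auto intro!: derivative_eq_intros simp: algebra_simps)
      from has_vector_derivative_real_field[OF this] show ?thesis
        by (simp add: cis_conv_exp)
    qed
    from has_vector_derivative_mult_right[OF this, of "- \<i> / of_real ?a"]
    show "(?F has_vector_derivative cis (?a * t)) (at t within {0..1})"
      using assms by (simp add: field_simps)
  qed (auto intro!: continuous_intros)
  also have "\<dots> = 0"
  proof -
    have "cis ?a = 1" by (rule cis_multiple_2pi) simp
    then show ?thesis by simp
  qed
  finally show ?thesis .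
qed

lemma Basis_real2: "(Basis :: (real ^ 2) set) = {axis 1 1, axis 2 1}"
  by (auto simp: Basis_vec_def UNIV_2)

lemma axis_12: "axis 1 1 \<noteq> (axis 2 1 :: real ^ 2)"
  by (simp add: axis_eq_axis)

text \<open>Orthogonality of characters. Lebesgue measure is a product measure and a character is a product of
  one-dimensional exponentials, one of which has a nonzero frequency.\<close>

lemma integral_wave:
  "(LINT u|square. wave k u) = (if k = 0 then 1 else 0)"
proof (cases "k = 0")
  case True
  then show ?thesis by simp
next
  case False
  define m where "m b = (if b = axis 1 1 then fst k else snd k)" for b :: "real ^ 2"
  define g where "g b t = indicator {0..<1} t *\<^sub>R cis (2 * pi * (of_int (m b) * t))" for b and t :: real
  interpret product_sigma_finite "\<lambda>b :: real ^ 2. lborel :: real measure" ..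
  have g_meas [measurable]: "g b \<in> borel_measurable borel" for b
    unfolding g_def
    by (intro borel_measurable_scaleR borel_measurable_indicator borel_measurable_continuous_onI
        continuous_intros) auto
  have g_int: "integrable lborel (g b)" for b
  proof (rule Bochner_Integration.integrable_bound)
    show "integrable lborel (indicator {0..<1::real} :: real \<Rightarrow> real)" by simp
  qed (auto simp: g_def indicator_def)
  have "(LINT u|square. wave k u) = (LINT u|lborel. indicator unit_square u *\<^sub>R wave k u)"
    unfolding square_def using unit_square_sets by (intro integral_restrict_space) simp
  also have "\<dots> = (LINT u|lborel. (\<Prod>b\<in>Basis. g b (inner u b)))"
  proof (intro Bochner_Integration.integral_cong refl)
    fix u :: "real ^ 2"
    show "indicator unit_square u *\<^sub>R wave k u = (\<Prod>b\<in>Basis. g b (inner u b))"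
      using axis_12
      by (auto simp: Basis_real2 g_def m_def inner_axis wave_def cis_mult indicator_def
          unit_square_def forall_2 algebra_simps)
  qed
  also have "\<dots> = (LINT f|(\<Pi>\<^sub>M b\<in>Basis. lborel). (\<Prod>b\<in>Basis. g b (inner (\<Sum>b'\<in>Basis. f b' *\<^sub>R b') b)))"
    by (subst lborel_eq, subst integral_distr) (auto intro!: borel_measurable_prod)
  also have "\<dots> = (LINT f|(\<Pi>\<^sub>M b\<in>Basis. lborel). (\<Prod>b\<in>(Basis :: (real ^ 2) set). g b (f b)))"
    by (intro Bochner_Integration.integral_cong refl prod.cong) simp_all
  also have "\<dots> = (\<Prod>b\<in>(Basis :: (real ^ 2) set). LINT t|lborel. g b t)"
    by (rule product_integral_prod) (auto simp: g_int)
  also have "\<dots> = 0"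
  proof -
    have "fst k \<noteq> 0 \<or> snd k \<noteq> 0" using False by (auto simp: prod_eq_iff)
    then have "\<exists>b\<in>(Basis :: (real ^ 2) set). m b \<noteq> 0"
      using axis_12 by (auto simp: Basis_real2 m_def)
    then obtain b where "b \<in> (Basis :: (real ^ 2) set)" "m b \<noteq> 0" by blast
    then show ?thesis using integral_cis_unit_interval[of "m b"]
      by (intro prod_zero) (auto simp: g_def)
  qed
  finally show ?thesis using False by simp
qed

section \<open>Approximation by Fejer means\<close>

text \<open>The differences of points of the grid are the frequencies at most \<open>N - 1\<close>. Sums indexed by pairs of grid
  points, rather than by frequencies, have the multiplicities of the Fejer kernel built in.\<close>

definition grid :: "nat \<Rightarrow> (int \<times> int) set" where
  "grid N = {0..<int N} \<times> {0..<int N}"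

lemma finite_grid [simp]: "finite (grid N)"
  by (simp add: grid_def)

lemma card_grid: "card (grid N) = N\<^sup>2"
  by (simp add: grid_def power2_eq_square)

text \<open>The two-dimensional Fejer kernel. As a normalised square it is nonnegative, and as a trigonometric
  polynomial its integrals are counted by \<open>integral_fejer_wave\<close>.\<close>

definition fejer :: "nat \<Rightarrow> real ^ 2 \<Rightarrow> real" where
  "fejer N w = (cmod (\<Sum>i\<in>grid N. wave i w))\<^sup>2 / (real N)\<^sup>2"

lemma fejer_nonneg [simp]: "fejer N w \<ge> 0"
  by (simp add: fejer_def)

lemma fejer_expansion:
  "complex_of_real (fejer N w)
    = (\<Sum>p\<in>grid N \<times> grid N. wave (fst p - snd p) w) / (of_nat N)\<^sup>2"
proof -
  have "complex_of_real ((cmod (\<Sum>i\<in>grid N. wave i w))\<^sup>2)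
      = (\<Sum>i\<in>grid N. wave i w) * (\<Sum>j\<in>grid N. wave (- j) w)"
    unfolding complex_norm_square by (simp add: wave_uminus)
  also have "\<dots> = (\<Sum>i\<in>grid N. \<Sum>j\<in>grid N. wave (i - j) w)"
    by (simp add: sum_product flip: wave_add)
  finally show ?thesis
    unfolding fejer_def of_real_divide by (simp add: sum.cartesian_product case_prod_unfold)
qed

lemma continuous_fejer [continuous_intros]:
  "continuous_on S g \<Longrightarrow> continuous_on S (\<lambda>u. fejer N (g u))"
  unfolding fejer_def divide_inverse by (intro continuous_intros)

lemma integral_wave_translate:
  "(LINT v|square. wave k (u - v)) = (if k = 0 then 1 else 0)"
  by (simp add: wave_diff_arg integral_wave)

lemma integral_fejer_wave:
  "(LINT v|square. complex_of_real (fejer N (u - v)) * wave e (u - v))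
    = of_nat (card {i \<in> grid N. i + e \<in> grid N}) / (of_nat N)\<^sup>2"
proof -
  have "(LINT v|square. complex_of_real (fejer N (u - v)) * wave e (u - v))
     = (LINT v|square. (\<Sum>p\<in>grid N \<times> grid N. wave (fst p - snd p + e) (u - v)) / (of_nat N)\<^sup>2)"
    by (intro Bochner_Integration.integral_cong refl)
      (simp add: fejer_expansion sum_distrib_right wave_add)
  also have "\<dots> = (\<Sum>p\<in>grid N \<times> grid N. LINT v|square. wave (fst p - snd p + e) (u - v)) / (of_nat N)\<^sup>2"
    by (simp, subst Bochner_Integration.integral_sum)
      (auto intro!: integrable_square continuous_intros)
  also have "(\<Sum>p\<in>grid N \<times> grid N. LINT v|square. wave (fst p - snd p + e) (u - v))
     = (\<Sum>i\<in>grid N. \<Sum>j\<in>grid N. if j = i + e then 1 else 0)"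
    unfolding integral_wave_translate sum.cartesian_product case_prod_unfold
    by (intro sum.cong refl) (auto simp: algebra_simps eq_neg_iff_add_eq_0)
  also have "\<dots> = (\<Sum>i\<in>grid N. if i + e \<in> grid N then 1 else 0)"
    by (intro sum.cong refl) simp
  also have "\<dots> = of_nat (card {i \<in> grid N. i + e \<in> grid N})"
    by (simp flip: sum.inter_filter)
  finally show ?thesis .
qed

text \<open>The sum of the squares of the sines of \<open>pi\<close> times the coordinates. It is a trigonometric
  polynomial of degree one, so its integral against the Fejer kernel is explicit, and it dominates
  the squared distance on the torus.\<close>

definition chord :: "real ^ 2 \<Rightarrow> real" where
  "chord w = 1 - (Re (wave (1, 0) w) + Re (wave (0, 1) w)) / 2"

lemma chord_eq: "chord w = (1 - cos (2 * pi * w $ 1)) / 2 + (1 - cos (2 * pi * w $ 2)) / 2"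
  by (simp add: chord_def wave_def field_simps)

lemma continuous_chord [continuous_intros]:
  "continuous_on S g \<Longrightarrow> continuous_on S (\<lambda>u. chord (g u))"
  unfolding chord_def by (intro continuous_intros) auto

lemma integral_fejer:
  assumes "N \<ge> 1"
  shows "(LINT v|square. fejer N (u - v)) = 1"
proof -
  have "complex_of_real (LINT v|square. fejer N (u - v))
      = (LINT v|square. complex_of_real (fejer N (u - v)) * wave 0 (u - v))"
    by simp
  also have "\<dots> = 1" unfolding integral_fejer_wave using assms by (simp add: card_grid)
  finally show ?thesis by (simp only: of_real_eq_1_iff)
qed

lemma integral_fejer_Re_wave:
  "(LINT v|square. fejer N (u - v) * Re (wave e (u - v)))
    = real (card {i \<in> grid N. i + e \<in> grid N}) / (real N)\<^sup>2"
proof -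
  have "(LINT v|square. fejer N (u - v) * Re (wave e (u - v)))
      = Re (LINT v|square. complex_of_real (fejer N (u - v)) * wave e (u - v))"
    by (subst integral_Re[symmetric]) (auto intro!: integrable_square continuous_intros)
  also have "\<dots> = real (card {i \<in> grid N. i + e \<in> grid N}) / (real N)\<^sup>2"
  proof -
    have "of_nat k / (of_nat N)\<^sup>2 = complex_of_real (real k / (real N)\<^sup>2)" for k by simp
    then show ?thesis unfolding integral_fejer_wave by (simp only: Re_complex_of_real)
  qed
  finally show ?thesis .
qed

text \<open>The Fejer coefficient at a unit frequency is \<open>1 - 1 / N\<close>, so the kernel is concentrated near zero
  with second moment of order \<open>1 / N\<close>.\<close>

lemma integral_fejer_chord:
  assumes "N \<ge> 1"
  shows "(LINT v|square. fejer N (u - v) * chord (u - v)) = 1 / real N"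
proof -
  have "{i \<in> grid N. i + (1, 0) \<in> grid N} = {0..<int N - 1} \<times> {0..<int N}"
    "{i \<in> grid N. i + (0, 1) \<in> grid N} = {0..<int N} \<times> {0..<int N - 1}"
    by (auto simp: grid_def)
  then have card: "card {i \<in> grid N. i + (1, 0) \<in> grid N} = (N - 1) * N"
    "card {i \<in> grid N. i + (0, 1) \<in> grid N} = (N - 1) * N"
    using assms by (simp_all add: nat_diff_distrib)
  have int: "integrable square (\<lambda>v. fejer N (u - v))"
    "integrable square (\<lambda>v. fejer N (u - v) * Re (wave e (u - v)))" for e
    by (intro integrable_square continuous_intros)+
  have "(LINT v|square. fejer N (u - v) * chord (u - v)) = (LINT v|square. fejer N (u - v) -
      (fejer N (u - v) * Re (wave (1, 0) (u - v)) + fejer N (u - v) * Re (wave (0, 1) (u - v))) / 2)"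
    by (intro Bochner_Integration.integral_cong refl) (simp add: chord_def algebra_simps)
  also have "\<dots> = 1 - real ((N - 1) * N) / (real N)\<^sup>2"
    using int by (simp add: integral_fejer[OF assms] integral_fejer_Re_wave card)
  also have "\<dots> = 1 / real N"
    using assms by (simp add: field_simps power2_eq_square of_nat_diff)
  finally show ?thesis .
qed

text \<open>Concavity of the sine on \<open>[0, pi]\<close>, compared with the chord from \<open>0\<close> to \<open>pi / 2\<close>.\<close>

lemma abs_le_abs_sin_pi:
  assumes "\<bar>t\<bar> \<le> 1/2" shows "\<bar>t\<bar> \<le> \<bar>sin (pi * t)\<bar>"
proof -
  have *: "t \<le> sin (pi * t)" if "0 \<le> t" "t \<le> 1/2" for t
  proof -
    have "concave_on {0..pi} sin"
      by (rule f''_le0_imp_concave[where f' = cos and f'' = "\<lambda>x. - sin x"])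
        (auto intro!: derivative_eq_intros simp: sin_ge_zero)
    from concave_onD[OF this, of "2 * t" 0 "pi / 2"]
    have "2 * t \<le> sin (2 * t * (pi / 2))" using that by simp
    then show ?thesis using that by (simp add: mult.commute)
  qed
  show ?thesis
  proof (cases "t \<ge> 0")
    case True then show ?thesis using *[of t] assms by simp
  next
    case False then show ?thesis using *[of "- t"] assms by simp
  qed
qed

lemma square_round_le:
  fixes x :: real
  defines "t \<equiv> x - of_int (round x)"
  shows "\<bar>t\<bar> \<le> 1/2" "t\<^sup>2 \<le> (1 - cos (2 * pi * x)) / 2"
proof -
  show t: "\<bar>t\<bar> \<le> 1/2" unfolding t_def using of_int_round_abs_le[of x] by (simp add: abs_minus_commute)
  have "t\<^sup>2 \<le> (sin (pi * t))\<^sup>2" using abs_le_abs_sin_pi[OF t] by (simp add: abs_le_square_iff)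
  also have "\<dots> = (1 - cos (2 * (pi * t))) / 2" using cos_double_sin[of "pi * t"] by simp
  also have "cos (2 * (pi * t)) = cos (2 * pi * x - 2 * pi * of_int (round x))"
    by (simp add: t_def algebra_simps)
  also have "\<dots> = cos (2 * pi * x)" by (simp add: cos_diff cos_int_2pin sin_int_2pin)
  finally show "t\<^sup>2 \<le> (1 - cos (2 * pi * x)) / 2" .
qed

lemma torus_dist_bounds:
  "dist (torus_proj u) (torus_proj v) \<le> 1"
  "(dist (torus_proj u) (torus_proj v))\<^sup>2 \<le> chord (u - v)"
proof -
  define v' where "v' = (\<chi> i. v $ i + of_int (round ((u - v) $ i)))"
  define t where "t i = (u - v) $ i - of_int (round ((u - v) $ i))" for i
  have "torus_proj v' = torus_proj v" by (simp add: torus_proj_eq_iff torus_rel_def v'_def)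
  then have d: "dist (torus_proj u) (torus_proj v) \<le> norm (u - v')"
    using dist_torus_proj_le[of u v'] by (simp add: dist_norm)
  have comp: "u $ i - v' $ i = t i" for i by (simp add: v'_def t_def)
  have n: "(norm (u - v'))\<^sup>2 = (t 1)\<^sup>2 + (t 2)\<^sup>2"
    unfolding power2_norm_eq_inner inner_vec_def sum_2 by (simp add: comp power2_eq_square)
  have d2: "(dist (torus_proj u) (torus_proj v))\<^sup>2 \<le> (t 1)\<^sup>2 + (t 2)\<^sup>2"
    unfolding n[symmetric] using d by (intro power_mono) auto
  also have "\<dots> \<le> chord (u - v)"
    unfolding chord_eq t_def by (intro add_mono square_round_le(2))
  finally show "(dist (torus_proj u) (torus_proj v))\<^sup>2 \<le> chord (u - v)" .
  have q: "(t i)\<^sup>2 \<le> 1/4" for i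
    using square_round_le(1)[of "(u - v) $ i"] abs_le_square_iff[of "t i" "1/2"]
    by (simp add: t_def power2_eq_square)
  have "(dist (torus_proj u) (torus_proj v))\<^sup>2 \<le> 1" using d2 q[of 1] q[of 2] by linarith
  then have "(dist (torus_proj u) (torus_proj v))\<^sup>2 \<le> 1\<^sup>2" by simp
  then show "dist (torus_proj u) (torus_proj v) \<le> 1" by (rule power2_le_imp_le) simp
qed

text \<open>This trades the Hoelder modulus for a quadratic one, whose mean against the Fejer kernel is known.\<close>

lemma powr_le_interpolate:
  fixes d \<delta> g :: real
  assumes "0 \<le> d" "d \<le> 1" "\<delta> > 0" "g > 0"
  shows "d powr g \<le> \<delta> powr g + d\<^sup>2 / \<delta>\<^sup>2"
proof (cases "d \<le> \<delta>")
  case True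
  then have "d powr g \<le> \<delta> powr g" using assms by (intro powr_mono2) auto
  then show ?thesis by (simp add: add_increasing2)
next
  case False
  have "d powr g \<le> 1 powr g" using assms by (intro powr_mono2) auto
  also have "1 powr g \<le> d\<^sup>2 / \<delta>\<^sup>2" using False assms by (simp add: divide_simps power_mono)
  finally show ?thesis by (simp add: add_increasing)
qed

definition fejer_mean :: "nat \<Rightarrow> (torus \<Rightarrow> complex) \<Rightarrow> real ^ 2 \<Rightarrow> complex" where
  "fejer_mean N F u = (LINT v|square. F (torus_proj v) * of_real (fejer N (u - v)))"

lemma continuous_lift [continuous_intros]:
  fixes F :: "torus \<Rightarrow> complex"
  assumes "continuous_on UNIV F" "continuous_on S g"
  shows "continuous_on S (\<lambda>u. F (torus_proj (g u)))"
  by (rule continuous_on_compose2[OF assms(1) continuous_on_compose2[OF continuous_torus_proj assms(2)]])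
    auto

lemma fejer_mean_trigonometric:
  assumes "continuous_on UNIV F"
  shows "\<exists>c. \<forall>u. fejer_mean N F u = (\<Sum>p\<in>grid N \<times> grid N. c p * wave (fst p - snd p) u)"
proof (intro exI allI)
  fix u
  let ?c = "\<lambda>p. (LINT v|square. F (torus_proj v) * wave (snd p - fst p) v) / (of_nat N)\<^sup>2"
  have *: "F (torus_proj v) * of_real (fejer N (u - v))
      = (\<Sum>p\<in>grid N \<times> grid N. F (torus_proj v) * wave (snd p - fst p) v * (wave (fst p - snd p) u / (of_nat N)\<^sup>2))"
    for v
    by (simp add: fejer_expansion wave_diff_arg sum_distrib_left sum_divide_distrib mult_ac)
  have "fejer_mean N F u = (\<Sum>p\<in>grid N \<times> grid N.
      LINT v|square. F (torus_proj v) * wave (snd p - fst p) v * (wave (fst p - snd p) u / (of_nat N)\<^sup>2))"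
    unfolding fejer_mean_def *
    by (rule Bochner_Integration.integral_sum) (intro integrable_square continuous_intros assms; simp)
  then show "fejer_mean N F u = (\<Sum>p\<in>grid N \<times> grid N. ?c p * wave (fst p - snd p) u)"
    by (simp only: Bochner_Integration.integral_mult_left_zero) simp
qed

text \<open>The kernel is a probability density, so the error is the mean of \<open>F x - F y\<close> against it. The
  Hoelder bound is interpolated by \<open>powr_le_interpolate\<close>, and the quadratic part is at most \<open>chord\<close>.\<close>

lemma fejer_mean_error:
  assumes F: "continuous_on UNIV F" and H: "\<And>x y. norm (F x - F y) \<le> c * dist x y powr g"
    and pos: "g > 0" "c \<ge> 0" "N \<ge> 1" "\<delta> > 0"
  shows "norm (F (torus_proj u) - fejer_mean N F u) \<le> c * (\<delta> powr g + 1 / (\<delta>\<^sup>2 * real N))"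
proof -
  have "F (torus_proj u) = F (torus_proj u) * of_real (LINT v|square. fejer N (u - v))"
    by (simp add: integral_fejer[OF pos(3)])
  also have "\<dots> = (LINT v|square. F (torus_proj u) * of_real (fejer N (u - v)))" by simp
  finally have "F (torus_proj u) - fejer_mean N F u
      = (LINT v|square. (F (torus_proj u) - F (torus_proj v)) * of_real (fejer N (u - v)))"
    unfolding fejer_mean_def left_diff_distrib
    by (subst Bochner_Integration.integral_diff) (auto intro!: integrable_square continuous_intros F)
  also have "norm \<dots> \<le> (LINT v|square. c * (\<delta> powr g * fejer N (u - v) + fejer N (u - v) * chord (u - v) / \<delta>\<^sup>2))"
  proof (rule Bochner_Integration.integral_norm_bound_integral)
    fix v
    let ?d = "dist (torus_proj u) (torus_proj v)"
    have "?d powr g \<le> \<delta> powr g + ?d\<^sup>2 / \<delta>\<^sup>2"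
      using torus_dist_bounds(1) pos by (intro powr_le_interpolate) auto
    also have "\<dots> \<le> \<delta> powr g + chord (u - v) / \<delta>\<^sup>2"
      using torus_dist_bounds(2) by (intro add_left_mono divide_right_mono) auto
    finally have "norm (F (torus_proj u) - F (torus_proj v)) \<le> c * (\<delta> powr g + chord (u - v) / \<delta>\<^sup>2)"
      using H[of "torus_proj u" "torus_proj v"] mult_left_mono[OF _ pos(2)] order_trans by blast
    then have "norm (F (torus_proj u) - F (torus_proj v)) * fejer N (u - v)
        \<le> c * (\<delta> powr g + chord (u - v) / \<delta>\<^sup>2) * fejer N (u - v)"
      by (rule mult_right_mono) simp
    also have "\<dots> = c * (\<delta> powr g * fejer N (u - v) + fejer N (u - v) * chord (u - v) / \<delta>\<^sup>2)"
      by (simp add: algebra_simps)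
    finally show "norm ((F (torus_proj u) - F (torus_proj v)) * of_real (fejer N (u - v)))
        \<le> c * (\<delta> powr g * fejer N (u - v) + fejer N (u - v) * chord (u - v) / \<delta>\<^sup>2)"
      by (simp add: norm_mult)
  qed (use pos(4) in \<open>auto intro!: integrable_square continuous_intros F\<close>)
  also have "\<dots> = c * (\<delta> powr g + 1 / (\<delta>\<^sup>2 * real N))"
  proof -
    have "integrable square (\<lambda>v. \<delta> powr g * fejer N (u - v))"
      "integrable square (\<lambda>v. fejer N (u - v) * chord (u - v) / \<delta>\<^sup>2)"
      using pos by (auto intro!: integrable_square continuous_intros)
    then show ?thesis by (simp add: integral_fejer[OF pos(3)] integral_fejer_chord[OF pos(3)])
  qed
  finally show ?thesis .
qed

text \<open>Both error terms of \<open>fejer_mean_error\<close> are negative powers of \<open>N\<close> for \<open>\<delta> = N powr (- 1 / 4)\<close>. Any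
  negative power suffices, so no attempt is made at the optimal exponent.\<close>

lemma hoelder_trigonometric_approximation:
  assumes "hoelder F"
  shows "\<exists>C>0. \<exists>\<beta>>0. \<forall>N\<ge>1. \<exists>c. \<forall>u.
    norm (F (torus_proj u) - (\<Sum>p\<in>grid N \<times> grid N. c p * wave (fst p - snd p) u))
      \<le> C * real N powr - \<beta>"
proof -
  obtain g c where gc: "g > 0" "c > 0" "\<And>x y. norm (F x - F y) \<le> c * dist x y powr g"
    using assms unfolding hoelder_def by blast
  have F: "continuous_on UNIV F" by (rule hoelder_continuous[OF assms])
  define \<beta> where "\<beta> = min (g / 4) (1 / 2)"
  show ?thesis
  proof (rule exI[of _ "2 * c"], intro conjI exI[of _ \<beta>] allI impI)
    fix N :: nat assume N: "N \<ge> 1"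
    define \<delta> where "\<delta> = real N powr (- 1 / 4)"
    have \<delta>: "\<delta> > 0" using N by (simp add: \<delta>_def)
    have "\<delta> powr g = real N powr (- (g / 4))" by (simp add: \<delta>_def powr_powr)
    also have "\<dots> \<le> real N powr - \<beta>" using N by (intro powr_mono) (auto simp: \<beta>_def)
    finally have 1: "\<delta> powr g \<le> real N powr - \<beta>" .
    have "\<delta>\<^sup>2 * real N = real N powr (- 1 / 2) * real N powr 1"
      using N by (simp add: \<delta>_def power2_eq_square flip: powr_add)
    also have "\<dots> = real N powr (1 / 2)" by (simp only: powr_add[symmetric]) simp
    finally have "1 / (\<delta>\<^sup>2 * real N) = real N powr (- (1 / 2))" by (simp add: powr_minus_divide)
    also have "\<dots> \<le> real N powr - \<beta>" using N by (intro powr_mono) (auto simp: \<beta>_def)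
    finally have 2: "1 / (\<delta>\<^sup>2 * real N) \<le> real N powr - \<beta>" .
    have "norm (F (torus_proj u) - fejer_mean N F u) \<le> 2 * c * real N powr - \<beta>" for u
    proof -
      have "norm (F (torus_proj u) - fejer_mean N F u) \<le> c * (\<delta> powr g + 1 / (\<delta>\<^sup>2 * real N))"
        by (rule fejer_mean_error[OF F gc(3)]) (use gc N \<delta> in auto)
      also have "\<dots> \<le> c * (real N powr - \<beta> + real N powr - \<beta>)"
        using 1 2 gc(2) by (intro mult_left_mono) auto
      finally show ?thesis by simp
    qed
    moreover obtain c' where "\<forall>u. fejer_mean N F u = (\<Sum>p\<in>grid N \<times> grid N. c' p * wave (fst p - snd p) u)"
      using fejer_mean_trigonometric[OF F] by (rule exE)
    ultimately show "\<exists>c'. \<forall>u. norm (F (torus_proj u) - (\<Sum>p\<in>grid N \<times> grid N. c' p * wave (fst p - snd p) u))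
      \<le> 2 * c * real N powr - \<beta>"
      by (intro exI[of _ c']) simp
  qed (use gc in \<open>auto simp: \<beta>_def\<close>)
qed

section \<open>Correlations of resonance-free matrices\<close>

lemma row_act_zero [simp]: "row_act 0 A = 0"
  by (simp add: row_act_def zero_prod_def)

lemma wave_act: "wave k (map_matrix real_of_int A *v u) = wave (row_act k A) u"
  by (simp add: wave_def row_act_def matrix_vector_mult_def sum_2 algebra_simps)

lemma frequency_le_grid_diff: "p \<in> grid N \<times> grid N \<Longrightarrow> frequency_le N (fst p - snd p)"
  by (auto simp: frequency_le_def grid_def)

text \<open>The product of the characters of frequencies \<open>k\<close> and \<open>l\<close>, the first composed with \<open>A\<close>, is the
  character of frequency \<open>row_act k A + l\<close>. Without resonances this frequency vanishes only for
  \<open>k = l = 0\<close>, so only the product of the constant terms survives.\<close>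

lemma trigonometric_decorrelation:
  assumes "resonance_free N A"
  defines "P c u \<equiv> \<Sum>p\<in>grid N \<times> grid N. c p * wave (fst p - snd p) u"
  shows "(LINT u|square. P c (map_matrix real_of_int A *v u) * P d u)
    = (LINT u|square. P c u) * (LINT u|square. P d u)"
proof -
  let ?\<kappa> = "\<lambda>p :: (int \<times> int) \<times> (int \<times> int). fst p - snd p" and ?G = "grid N \<times> grid N"
  have int: "(LINT u|square. P c u) = (\<Sum>p\<in>?G. if ?\<kappa> p = 0 then c p else 0)" for c
    unfolding P_def
    by (subst Bochner_Integration.integral_sum)
      (auto simp: integral_wave if_distrib intro!: integrable_square continuous_intros sum.cong)
  have "(LINT u|square. P c (map_matrix real_of_int A *v u) * P d u)
      = (LINT u|square. (\<Sum>p\<in>?G. \<Sum>q\<in>?G. c p * d q * wave (row_act (?\<kappa> p) A + ?\<kappa> q) u))"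
    by (intro Bochner_Integration.integral_cong refl)
      (simp only: P_def sum_product wave_act wave_add, simp only: mult_ac)
  also have "\<dots> = (\<Sum>p\<in>?G. LINT u|square. (\<Sum>q\<in>?G. c p * d q * wave (row_act (?\<kappa> p) A + ?\<kappa> q) u))"
    by (rule Bochner_Integration.integral_sum) (intro integrable_square continuous_intros; simp)
  also have "\<dots> = (\<Sum>p\<in>?G. \<Sum>q\<in>?G. LINT u|square. c p * d q * wave (row_act (?\<kappa> p) A + ?\<kappa> q) u)"
    by (intro sum.cong refl Bochner_Integration.integral_sum) (intro integrable_square continuous_intros)
  also have "\<dots> = (\<Sum>p\<in>?G. \<Sum>q\<in>?G. (if ?\<kappa> p = 0 then c p else 0) * (if ?\<kappa> q = 0 then d q else 0))"
  proof (intro sum.cong refl)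
    fix p q assume pq: "p \<in> ?G" "q \<in> ?G"
    have "row_act (?\<kappa> p) A + ?\<kappa> q \<noteq> 0" if "?\<kappa> p \<noteq> 0"
    proof
      assume "row_act (?\<kappa> p) A + ?\<kappa> q = 0"
      then have "row_act (?\<kappa> p) A = - ?\<kappa> q" by (rule eq_neg_iff_add_eq_0[THEN iffD2])
      then have "frequency_le N (row_act (?\<kappa> p) A)"
        using frequency_le_grid_diff[OF pq(2)] by (simp add: frequency_le_def abs_minus_commute)
      then show False using assms(1) frequency_le_grid_diff[OF pq(1)] that unfolding resonance_free_def by blast
    qed
    then show "(LINT u|square. c p * d q * wave (row_act (?\<kappa> p) A + ?\<kappa> q) u)
        = (if ?\<kappa> p = 0 then c p else 0) * (if ?\<kappa> q = 0 then d q else 0)"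
      by (cases "?\<kappa> p = 0") (simp_all add: integral_wave)
  qed
  also have "\<dots> = (LINT u|square. P c u) * (LINT u|square. P d u)"
    by (simp add: int sum_product)
  finally show ?thesis .
qed

lemma norm_integral_square_le:
  fixes g :: "real ^ 2 \<Rightarrow> complex"
  assumes "continuous_on UNIV g" "\<And>u. norm (g u) \<le> B"
  shows "norm (LINT u|square. g u) \<le> B"
proof -
  have "norm (LINT u|square. g u) \<le> (LINT u|square. B)"
    by (rule Bochner_Integration.integral_norm_bound_integral)
      (auto intro!: integrable_square continuous_intros assms)
  then show ?thesis by simp
qed

lemma norm_mult_diff_le:
  fixes a b p q :: complex
  assumes "norm (a - p) \<le> e" "norm (b - q) \<le> e" "norm a \<le> M" "norm b \<le> M"
  shows "norm (a * b - p * q) \<le> e * (2 * M + e)"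
proof -
  have e: "e \<ge> 0" using assms(1) norm_ge_zero order_trans by blast
  have "norm p \<le> M + e" using norm_triangle_ineq2[of p a] assms(1,3) by (simp add: norm_minus_commute)
  have "a * b - p * q = (a - p) * b + p * (b - q)" by (simp add: algebra_simps)
  then have "norm (a * b - p * q) \<le> norm (a - p) * norm b + norm p * norm (b - q)"
    by (metis norm_mult norm_triangle_ineq)
  also have "\<dots> \<le> e * M + (M + e) * e"
    using assms e \<open>norm p \<le> M + e\<close> by (intro add_mono mult_mono) (auto intro: order_trans[OF norm_ge_zero])
  finally show ?thesis by (simp add: algebra_simps)
qed

lemma hoelder_bounded:
  assumes "hoelder F" shows "\<exists>M. \<forall>x. norm (F x) \<le> M"
proof -
  obtain g c where gc: "g > 0" "c > 0" "\<And>x y. norm (F x - F y) \<le> c * dist x y powr g"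
    using assms unfolding hoelder_def by blast
  show ?thesis
  proof (intro exI allI)
    fix x
    obtain u where u: "x = torus_proj u" using torus_proj_surj by blast
    have "dist x (torus_proj 0) powr g \<le> 1 powr g"
      unfolding u using torus_dist_bounds(1) gc by (intro powr_mono2) auto
    then have "c * dist x (torus_proj 0) powr g \<le> c" using gc by simp
    then show "norm (F x) \<le> norm (F (torus_proj 0)) + c"
      using gc(3)[of x "torus_proj 0"] norm_triangle_ineq2[of "F x" "F (torus_proj 0)"] by linarith
  qed
qed

text \<open>Replace both functions by trigonometric approximations, whose correlation vanishes exactly. Since
  everything is bounded, the replacement costs a multiple of the approximation error.\<close>

lemma correlation_le_of_resonance_free:
  assumes "hoelder F1" "hoelder F2"
  shows "\<exists>C>0. \<exists>\<beta>>0. \<forall>A. norm (correlation F1 F2 A) \<le> C \<and>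
    (\<forall>N\<ge>1. resonance_free N A \<longrightarrow> norm (correlation F1 F2 A) \<le> C * real N powr - \<beta>)"
proof -
  obtain M1 where M1: "\<forall>x. norm (F1 x) \<le> M1" using hoelder_bounded[OF assms(1)] by (rule exE)
  obtain M2 where M2: "\<forall>x. norm (F2 x) \<le> M2" using hoelder_bounded[OF assms(2)] by (rule exE)
  define M where "M = max M1 M2"
  have M: "norm (F1 x) \<le> M" "norm (F2 x) \<le> M" for x
    using M1[rule_format, of x] M2[rule_format, of x] by (simp_all add: M_def)
  have M0: "M \<ge> 0" using order_trans[OF norm_ge_zero M(1)] .
  have F: "continuous_on UNIV F1" "continuous_on UNIV F2"
    using assms by (simp_all add: hoelder_continuous)
  let ?f1 = "\<lambda>u. F1 (torus_proj u)" and ?f2 = "\<lambda>u. F2 (torus_proj u)"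
  let ?P = "\<lambda>N c u. \<Sum>p\<in>grid N \<times> grid N. c p * wave (fst p - snd p) u"
  obtain C1 b1 where 1: "C1 > 0" "b1 > 0"
    "\<forall>N\<ge>1. \<exists>c. \<forall>u. norm (?f1 u - ?P N c u) \<le> C1 * real N powr - b1"
    using hoelder_trigonometric_approximation[OF assms(1)] by blast
  obtain C2 b2 where 2: "C2 > 0" "b2 > 0"
    "\<forall>N\<ge>1. \<exists>c. \<forall>u. norm (?f2 u - ?P N c u) \<le> C2 * real N powr - b2"
    using hoelder_trigonometric_approximation[OF assms(2)] by blast
  define C0 where "C0 = max C1 C2"
  define \<beta> where "\<beta> = min b1 b2"
  \<comment> \<open>the second summand covers matrices with resonances\<close>
  define C where "C = 2 * C0 * (2 * M + C0) + 2 * M * M"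
  have C0: "C0 > 0" and \<beta>: "\<beta> > 0" using 1 2 by (auto simp: C0_def \<beta>_def)
  have actc: "continuous_on UNIV (\<lambda>u. map_matrix real_of_int A *v u)" for A
    by (intro linear_continuous_on matrix_vector_mul_bounded_linear)
  have corr: "correlation F1 F2 A = (LINT u|square. ?f1 (map_matrix real_of_int A *v u) * ?f2 u)
      - (LINT u|square. ?f1 u) * (LINT u|square. ?f2 u)" for A
    by (rule correlation_square[OF F])
  have I: "norm (LINT u|square. ?f1 u) \<le> M" "norm (LINT u|square. ?f2 u) \<le> M"
    using M by (auto intro!: norm_integral_square_le continuous_intros F)
  show ?thesis
  proof (rule exI[of _ C], intro conjI exI[of _ \<beta>] allI impI)
    show "\<beta> > 0" by (rule \<beta>)
    have "2 * C0 * (2 * M + C0) > 0" using C0 M0 by (intro mult_pos_pos add_nonneg_pos) auto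
    then show "C > 0" using M0 unfolding C_def by (intro add_pos_nonneg) auto
    fix A :: "int ^ 2 ^ 2"
    have "norm (LINT u|square. ?f1 (map_matrix real_of_int A *v u) * ?f2 u) \<le> M * M"
      using M M0 by (intro norm_integral_square_le continuous_intros F actc)
        (auto simp: norm_mult intro!: mult_mono)
    moreover have "norm ((LINT u|square. ?f1 u) * (LINT u|square. ?f2 u)) \<le> M * M"
      unfolding norm_mult using I M0 by (intro mult_mono) auto
    moreover have "0 \<le> 2 * C0 * (2 * M + C0)" using C0 M0 by simp
    ultimately show "norm (correlation F1 F2 A) \<le> C"
      unfolding corr C_def
      using norm_triangle_ineq4[of "LINT u|square. ?f1 (map_matrix real_of_int A *v u) * ?f2 u"
          "(LINT u|square. ?f1 u) * (LINT u|square. ?f2 u)"] by linarith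
    fix N :: nat assume N: "N \<ge> 1" and free: "resonance_free N A"
    define e where "e = C0 * real N powr - \<beta>"
    have e1: "C1 * real N powr - b1 \<le> e" and e2: "C2 * real N powr - b2 \<le> e"
      using N C0 1 2 unfolding e_def
      by (auto intro!: mult_mono powr_mono simp: C0_def \<beta>_def)
    have "real N powr - \<beta> \<le> real N powr 0" using N \<beta> by (intro powr_mono) auto
    then have e: "0 \<le> e" "e \<le> C0" using N C0 by (auto simp: e_def)
    obtain c where "\<forall>u. norm (?f1 u - ?P N c u) \<le> C1 * real N powr - b1" using 1(3)[rule_format, OF N] by (rule exE)
    then have c: "norm (?f1 u - ?P N c u) \<le> e" for u using e1 order_trans by blast
    obtain d where "\<forall>u. norm (?f2 u - ?P N d u) \<le> C2 * real N powr - b2" using 2(3)[rule_format, OF N] by (rule exE)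
    then have d: "norm (?f2 u - ?P N d u) \<le> e" for u using e2 order_trans by blast
    have Pc: "continuous_on UNIV (?P N b)" for b by (intro continuous_intros)
    have Pc': "continuous_on UNIV (\<lambda>u. ?P N b (map_matrix real_of_int A *v u))" for b
      by (rule continuous_on_compose2[OF Pc actc]) auto
    have eq: "(LINT u|square. ?f1 (map_matrix real_of_int A *v u) * ?f2 u
        - ?P N c (map_matrix real_of_int A *v u) * ?P N d u)
      = (LINT u|square. ?f1 (map_matrix real_of_int A *v u) * ?f2 u)
        - (LINT u|square. ?P N c u) * (LINT u|square. ?P N d u)"
      unfolding trigonometric_decorrelation[OF free, symmetric]
      by (rule Bochner_Integration.integral_diff)
        (intro integrable_square continuous_intros F actc Pc' Pc)+
    have "norm (LINT u|square. ?f1 (map_matrix real_of_int A *v u) * ?f2 u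
        - ?P N c (map_matrix real_of_int A *v u) * ?P N d u) \<le> e * (2 * M + e)"
      using M by (intro norm_integral_square_le norm_mult_diff_le c d)
        (auto intro!: continuous_intros F actc Pc' Pc)
    note joint = this[unfolded eq]
    have product: "norm ((LINT u|square. ?f1 u) * (LINT u|square. ?f2 u)
        - (LINT u|square. ?P N c u) * (LINT u|square. ?P N d u)) \<le> e * (2 * M + e)"
    proof (rule norm_mult_diff_le)
      have "(LINT u|square. ?f1 u) - (LINT u|square. ?P N c u) = (LINT u|square. ?f1 u - ?P N c u)"
        by (rule Bochner_Integration.integral_diff[symmetric]) (intro integrable_square continuous_intros F)+
      then show "norm ((LINT u|square. ?f1 u) - (LINT u|square. ?P N c u)) \<le> e"
        by (simp only:) (intro norm_integral_square_le c continuous_intros F)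
      have "(LINT u|square. ?f2 u) - (LINT u|square. ?P N d u) = (LINT u|square. ?f2 u - ?P N d u)"
        by (rule Bochner_Integration.integral_diff[symmetric]) (intro integrable_square continuous_intros F)+
      then show "norm ((LINT u|square. ?f2 u) - (LINT u|square. ?P N d u)) \<le> e"
        by (simp only:) (intro norm_integral_square_le d continuous_intros F)
    qed (rule I)+
    have "norm (x - y) \<le> 2 * b" if "norm (x - z) \<le> b" "norm (y - z) \<le> b"
      for x y z :: complex and b
      using norm_triangle_ineq4[of "x - z" "y - z"] that by simp
    from this[OF joint product] have "norm (correlation F1 F2 A) \<le> 2 * (e * (2 * M + e))"
      unfolding corr .
    also have "\<dots> \<le> 2 * (e * (2 * M + C0))" using e M0 by (intro mult_left_mono add_left_mono) auto
    also have "\<dots> = 2 * C0 * (2 * M + C0) * real N powr - \<beta>" by (simp add: e_def)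
    also have "\<dots> \<le> C * real N powr - \<beta>" unfolding C_def using M0 by (intro mult_right_mono) auto
    finally show "norm (correlation F1 F2 A) \<le> C * real N powr - \<beta>" .
  qed
qed

theorem theorem5:
  fixes h :: "int ^ 2 ^ 2" and \<phi> :: "nat \<Rightarrow> int ^ 2 ^ 2"
  assumes "h \<in> SL2Z"
    and "hyperbolic h"
    and "\<not> conjugate_SL2Z h (matrix_inv h)"
    and "\<And>i. i \<ge> 1 \<Longrightarrow> \<phi> i \<in> SL2Z"
    and "bounded ((\<lambda>i. trace (\<phi> i)) ` {1..})"
  shows "\<exists>t0::nat. \<forall>t>t0. \<forall>F1 F2. hoelder F1 \<longrightarrow> hoelder F2 \<longrightarrow>
           (\<exists>c>0. \<exists>\<gamma>>0. \<forall>n\<ge>1.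
              norm (correlation F1 F2 (kicked_product h \<phi> t n)) \<le> c * exp (- \<gamma> * real n))"
proof -
  obtain t0 :: nat and \<rho> K :: real where \<rho>: "\<rho> > 1" and K: "K > 0"
    and free: "\<forall>t>t0. \<forall>n N. K * real N ^ 4 < \<rho> ^ n \<longrightarrow> resonance_free N (kicked_product h \<phi> t n)"
    using kicked_product_resonance_free[OF assms] by blast
  show ?thesis
  proof (intro exI[of _ t0] allI impI)
    fix t F1 F2 assume t: "t0 < t" and F: "hoelder F1" "hoelder F2"
    obtain C \<beta> where C: "C > 0" "\<beta> > 0" "\<forall>A. norm (correlation F1 F2 A) \<le> C \<and>
      (\<forall>N\<ge>1. resonance_free N A \<longrightarrow> norm (correlation F1 F2 A) \<le> C * real N powr - \<beta>)"
      using correlation_le_of_resonance_free[OF F] by blast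
    define c where "c = C * 2 powr \<beta> * (2 * K) powr (\<beta> / 4)"
    define \<gamma> where "\<gamma> = ln \<rho> * \<beta> / 4"
    have "norm (correlation F1 F2 (kicked_product h \<phi> t n)) \<le> c * exp (- \<gamma> * real n)" for n
    proof -
      \<comment> \<open>chosen such that \<open>K * X ^ 4\<close> is half of \<open>\<rho> ^ n\<close>\<close>
      define X where "X = (\<rho> ^ n / (2 * K)) powr (1 / 4)"
      define N where "N = nat \<lfloor>X\<rfloor>"
      have X: "X > 0" using \<rho> K by (simp add: X_def)
      have X4: "X ^ 4 = \<rho> ^ n / (2 * K)"
        using \<rho> K X by (simp add: X_def powr_powr flip: powr_realpow)
      have "norm (correlation F1 F2 (kicked_product h \<phi> t n)) \<le> C * (X / 2) powr - \<beta>"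
      proof (cases "N \<ge> 1")
        case True
        have NX: "real N \<le> X" "X / 2 \<le> real N" using True X unfolding N_def by linarith+
        have "K * real N ^ 4 \<le> K * X ^ 4" using NX(1) K by (intro mult_left_mono power_mono) auto
        also have "\<dots> = \<rho> ^ n / 2" using K by (simp add: X4)
        also have "\<dots> < \<rho> ^ n" using \<rho> by simp
        finally have "resonance_free N (kicked_product h \<phi> t n)" using free t by blast
        then have "norm (correlation F1 F2 (kicked_product h \<phi> t n)) \<le> C * real N powr - \<beta>"
          using C(3) True by blast
        also have "\<dots> \<le> C * (X / 2) powr - \<beta>"
          using NX X C by (intro mult_left_mono powr_mono2') auto
        finally show ?thesis .
      next
        case False
        \<comment> \<open>for the finitely many \<open>n\<close> with \<open>X < 1\<close>, the trivial bound suffices\<close>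
        then have "X / 2 \<le> 1" using X unfolding N_def by linarith
        then have "1 powr - \<beta> \<le> (X / 2) powr - \<beta>" using X C(2) by (intro powr_mono2') auto
        then have "C * 1 \<le> C * (X / 2) powr - \<beta>" using C(1) by (intro mult_left_mono) auto
        then show ?thesis using C(3)[rule_format, of "kicked_product h \<phi> t n"] by linarith
      qed
      also have "(X / 2) powr - \<beta> = 2 powr \<beta> * ((2 * K) powr (\<beta> / 4) * exp (- \<gamma> * real n))"
      proof -
        have lnX: "ln X = (real n * ln \<rho> - ln (2 * K)) / 4"
          using \<rho> K by (simp add: X_def ln_powr ln_div ln_realpow)
        have "(X / 2) powr - \<beta> = exp (- \<beta> * (ln X - ln 2))"
          using X by (simp add: powr_def ln_div)
        also have "- \<beta> * (ln X - ln 2) = \<beta> * ln 2 + (\<beta> / 4 * ln (2 * K) + - \<gamma> * real n)"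
          unfolding lnX \<gamma>_def by (simp add: field_simps)
        finally show ?thesis using K unfolding exp_add by (simp add: powr_def)
      qed
      finally show ?thesis by (simp add: c_def mult_ac)
    qed
    moreover have "c > 0" "\<gamma> > 0" using C K \<rho> by (simp_all add: c_def \<gamma>_def)
    ultimately show "\<exists>c>0. \<exists>\<gamma>>0. \<forall>n\<ge>1.
        norm (correlation F1 F2 (kicked_product h \<phi> t n)) \<le> c * exp (- \<gamma> * real n)" by blast
  qed
qed

end
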